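(* Let $\{\mu_i\}_{i=1}^k$ be a monotonically decreasing (non-increasing) sequence of strictly positive numbers with $\sum_{i=1}^k\mu_i=1$, let $n\ge k$ and $n'\ge k$, and define unital $q$-positive maps $\phi:M_n(\mathbb{C})\to M_n(\mathbb{C})$ and $\psi:M_{n'}(\mathbb{C})\to M_{n'}(\mathbb{C})$ by $$\phi(A)=\Big(\sum_{i=1}^k\mu_ia_{ii}\Big)I_n,\qquad \psi(D)=\Big(\sum_{i=1}^{k}\mu_id_{ii}\Big)I_{n'}$$ for all $A=(a_{ij})\in M_n(\mathbb{C})$ and $D=(d_{ij})\in M_{n'}(\mathbb{C})$. Let $\Omega=\operatorname{diag}(\mu_1,\ldots,\mu_k)\in M_k(\mathbb{C})$. Let $\gamma:M_{n,n'}(\mathbb{C})\to M_{n,n'}(\mathbb{C})$ be a $q$-corner from $\phi$ to $\psi$, and let $X\in M_k(\mathbb{C})$ be a unitary commuting with $\Omega$, $E\in M_{n-k,n'-k}(\mathbb{C})$ a contraction, and $\lambda\in\mathbb{C}$ with $|\lambda|^2\le\operatorname{Re}(\lambda)$, such that $$\gamma\begin{pmatrix}B_{k,k}&W_{k,n'-k}\\Q_{n-k,k}&Y_{n-k,n'-k}\end{pmatrix}=\lambda\,\operatorname{tr}(X^*B_{k,k}\Omega)\begin{pmatrix}X&0_{k,n'-k}\\0_{n-k,k}&E\end{pmatrix}$$ for all $\begin{pmatrix}B_{k,k}&W_{k,n'-k}\\Q_{n-k,k}&Y_{n-k,n'-k}\end{pmatrix}\in M_{n,n'}(\mathbb{C})$.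 Then $\gamma$ is hyper maximal if and only if $n=n'$, $0<|\lambda|^2=\operatorname{Re}(\lambda)$, and $E$ is unitary.
   Context: $M_{p,q}(\mathbb{C})$ is the space of $p\times q$ complex matrices; subscripts $p,q$ on a block indicate its size; blocks with a zero dimension are absent (and an empty square matrix counts as unitary). A contraction is a matrix of operator norm at most $1$; $\operatorname{tr}$ is the usual (unnormalized) trace. A linear map $\Theta:M_m(\mathbb{C})\to M_m(\mathbb{C})$ with no negative eigenvalues is $q$-positive, written $\Theta\ge_q0$, if $\Theta(I+t\Theta)^{-1}$ is completely positive for all $t\ge0$ (with $I$ the identity map). For $q$-positive $\Theta,\Theta'$ on $M_m(\mathbb{C})$, write $\Theta\ge_q\Theta'$ if $\Theta(I+t\Theta)^{-1}-\Theta'(I+t\Theta')^{-1}$ is completely positive for all $t\ge0$. Given $q$-positive $\phi:M_n(\mathbb{C})\to M_n(\mathbb{C})$ and $\psi:M_{n'}(\mathbb{C})\to M_{n'}(\mathbb{C})$, a linear map $\gamma:M_{n,n'}(\mathbb{C})\to M_{n,n'}(\mathbb{C})$ is a $q$-corner from $\phi$ to $\psi$ if the map $\Theta=\begin{pmatrix}\phi&\gamma\\\gamma^*&\psi\end{pmatrix}$ on $M_{n+n'}(\mathbb{C})$, defined by $$\Theta\begin{pmatrix}A&B\\C&D\end{pmatrix}=\begin{pmatrix}\phi(A)&\gamma(B)\\\gamma^*(C)&\psi(D)\end{pmatrix},\qquad \gamma^*(C)=(\gamma(C^* ))^*,$$ satisfies $\Theta\ge_q0$. A $q$-corner $\gamma$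 is hyper maximal if, whenever $$\Theta\ge_q\Theta'=\begin{pmatrix}\phi'&\gamma\\\gamma^*&\psi'\end{pmatrix}\ge_q0$$ for linear maps $\phi'$ on $M_n(\mathbb{C})$ and $\psi'$ on $M_{n'}(\mathbb{C})$, we have $\Theta=\Theta'$. Fact making the hypothesis on the form of $\gamma$ non-restrictive: under these assumptions on $\phi$ and $\psi$, every $q$-corner from $\phi$ to $\psi$ is of the displayed form for some such $X$, $E$, $\lambda$. *)

theory Defs
  imports
    "Jordan_Normal_Form.Schur_Decomposition"
    "Jordan_Normal_Form.VS_Connect"
    "HOL-Analysis.L2_Norm"
begin

(* A map M_{p,q}(C) -> M_{p,q}(C) is a HOL function on complex mat of which only the
   values on carrier_mat p q matter. *)
abbreviation linear_on_mats :: "nat \<Rightarrow> nat \<Rightarrow> (complex mat \<Rightarrow> complex mat) \<Rightarrow> bool" where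
  "linear_on_mats p q f \<equiv>
     linear_map class_ring (module_mat TYPE(complex) p q) (module_mat TYPE(complex) p q) f"

definition mat_trace :: "complex mat \<Rightarrow> complex" where
  "mat_trace A = (\<Sum>i<dim_row A. A $$ (i, i))"

definition unitary_mat :: "complex mat \<Rightarrow> bool" where
  "unitary_mat U \<longleftrightarrow> square_mat U \<and>
     mat_adjoint U * U = 1\<^sub>m (dim_row U) \<and> U * mat_adjoint U = 1\<^sub>m (dim_row U)"

definition euclidean_norm_vec :: "complex vec \<Rightarrow> real" where
  "euclidean_norm_vec v = L2_set (\<lambda>i. norm (v $ i)) {..<dim_vec v}"

definition operator_norm_mat :: "complex mat \<Rightarrow> real" where
  "operator_norm_mat A =
     (SUP v \<in> {v \<in> carrier_vec (dim_col A). euclidean_norm_vec v \<le> 1}. euclidean_norm_vec (A *\<^sub>v v))"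

definition contraction_mat :: "complex mat \<Rightarrow> bool" where
  "contraction_mat A \<longleftrightarrow> operator_norm_mat A \<le> 1"

(* The order on complex is the one of HOL-Library.Complex_Order: 0 \<le> z says that z is
   real and nonnegative. *)
definition positive_mat :: "nat \<Rightarrow> complex mat \<Rightarrow> bool" where
  "positive_mat m A \<longleftrightarrow>
     A \<in> carrier_mat m m \<and> (\<forall>v \<in> carrier_vec m. 0 \<le> (A *\<^sub>v v) \<bullet>c v)"

(* id_r \<otimes> f on M_r(M_m(C)), an element of M_r(M_m(C)) being an rm x rm matrix cut into
   m x m blocks, to each of which f is applied. *)
definition ampliation :: "nat \<Rightarrow> nat \<Rightarrow> (complex mat \<Rightarrow> complex mat) \<Rightarrow> complex mat \<Rightarrow> complex mat" where
  "ampliation r m f A = mat (r * m) (r * m)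
     (\<lambda>(i, j). f (mat m m (\<lambda>(k, l). A $$ (i div m * m + k, j div m * m + l))) $$ (i mod m, j mod m))"

definition completely_positive :: "nat \<Rightarrow> (complex mat \<Rightarrow> complex mat) \<Rightarrow> bool" where
  "completely_positive m f \<longleftrightarrow> linear_on_mats m m f \<and>
     (\<forall>r A. positive_mat (r * m) A \<longrightarrow> positive_mat (r * m) (ampliation r m f A))"

definition eigenvalue_of_map :: "nat \<Rightarrow> (complex mat \<Rightarrow> complex mat) \<Rightarrow> complex \<Rightarrow> bool" where
  "eigenvalue_of_map m \<Theta> c \<longleftrightarrow> (\<exists>A \<in> carrier_mat m m. A \<noteq> 0\<^sub>m m m \<and> \<Theta> A = c \<cdot>\<^sub>m A)"

(* \<Theta> (I + t \<Theta>)^{-1}. If \<Theta> is linear without negative eigenvalues and t \<ge> 0, then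
   I + t \<Theta> is a bijection of carrier_mat m m, so inv_into is its inverse there. *)
definition q_transform :: "nat \<Rightarrow> (complex mat \<Rightarrow> complex mat) \<Rightarrow> real \<Rightarrow> complex mat \<Rightarrow> complex mat" where
  "q_transform m \<Theta> t B =
     \<Theta> (inv_into (carrier_mat m m) (\<lambda>A. A + complex_of_real t \<cdot>\<^sub>m \<Theta> A) B)"

definition q_positive :: "nat \<Rightarrow> (complex mat \<Rightarrow> complex mat) \<Rightarrow> bool" where
  "q_positive m \<Theta> \<longleftrightarrow> linear_on_mats m m \<Theta> \<and>
     (\<forall>r::real. eigenvalue_of_map m \<Theta> (complex_of_real r) \<longrightarrow> \<not> r < 0) \<and>
     (\<forall>t\<ge>0. completely_positive m (q_transform m \<Theta> t))"

definition q_dominates :: "nat \<Rightarrow> (complex mat \<Rightarrow> complex mat) \<Rightarrow> (complex mat \<Rightarrow> complex mat) \<Rightarrow> bool" where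
  "q_dominates m \<Theta> \<Theta>' \<longleftrightarrow> q_positive m \<Theta> \<and> q_positive m \<Theta>' \<and>
     (\<forall>t\<ge>0. completely_positive m (\<lambda>B. q_transform m \<Theta> t B - q_transform m \<Theta>' t B))"

definition corner_map ::
  "nat \<Rightarrow> (complex mat \<Rightarrow> complex mat) \<Rightarrow> (complex mat \<Rightarrow> complex mat) \<Rightarrow> (complex mat \<Rightarrow> complex mat)
    \<Rightarrow> complex mat \<Rightarrow> complex mat" where
  "corner_map n \<phi> \<gamma> \<psi> M = (case split_block M n n of (A, B, C, D) \<Rightarrow>
     four_block_mat (\<phi> A) (\<gamma> B) (mat_adjoint (\<gamma> (mat_adjoint C))) (\<psi> D))"

definition q_corner ::
  "nat \<Rightarrow> nat \<Rightarrow> (complex mat \<Rightarrow> complex mat) \<Rightarrow> (complex mat \<Rightarrow> complex mat) \<Rightarrow> (complex mat \<Rightarrow> complex mat)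
    \<Rightarrow> bool" where
  "q_corner n n' \<phi> \<psi> \<gamma> \<longleftrightarrow> q_positive n \<phi> \<and> q_positive n' \<psi> \<and>
     linear_on_mats n n' \<gamma> \<and> q_positive (n + n') (corner_map n \<phi> \<gamma> \<psi>)"

definition hyper_maximal ::
  "nat \<Rightarrow> nat \<Rightarrow> (complex mat \<Rightarrow> complex mat) \<Rightarrow> (complex mat \<Rightarrow> complex mat) \<Rightarrow> (complex mat \<Rightarrow> complex mat)
    \<Rightarrow> bool" where
  "hyper_maximal n n' \<phi> \<psi> \<gamma> \<longleftrightarrow> q_corner n n' \<phi> \<psi> \<gamma> \<and>
     (\<forall>\<phi>' \<psi>'. linear_on_mats n n \<phi>' \<longrightarrow> linear_on_mats n' n' \<psi>' \<longrightarrow>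
        q_dominates (n + n') (corner_map n \<phi> \<gamma> \<psi>) (corner_map n \<phi>' \<gamma> \<psi>') \<longrightarrow>
        (\<forall>M \<in> carrier_mat (n + n') (n + n'). corner_map n \<phi> \<gamma> \<psi> M = corner_map n \<phi>' \<gamma> \<psi>' M))"

end

theory Submission
  imports Defs
begin

text \<open>
  Write \<open>V\<close> for the contraction \<open>X \<oplus> E\<close>. All maps in sight have the shape
  \<open>M \<mapsto> W \<circ> \<rho>(M)\<close>, the entrywise product of a fixed weight matrix \<open>W\<close> with a matrix
  \<open>\<rho>(M)\<close> that is constant on the four blocks; such a map is completely positive as soon as \<open>W\<close> is
  positive semidefinite, and passing to \<open>\<Theta>(I + t\<Theta>)\<^sup>-\<^sup>1\<close> only rescales the blocks of \<open>W\<close>.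

  If \<open>\<gamma>\<close> is hyper maximal, compare \<open>\<Theta>\<close> with the maps obtained by replacing the identity
  blocks of its weight by \<open>c I\<close> with \<open>c = |\<lambda>|\<^sup>2 / Re \<lambda>\<close>, by \<open>V V\<^sup>*\<close>, or by \<open>V\<^sup>* V\<close>.

  Conversely, let \<open>V\<close> be unitary, \<open>Re (1 / \<lambda>) = 1\<close> and \<open>\<Theta> \<ge>\<^sub>q \<Theta>'\<close> with the same corner. The difference
  \<open>D\<^sub>t\<close> of the transforms is completely positive and block diagonal, and testing it on the positive
  matrices with identity diagonal blocks and off-diagonal blocks \<open>\<plusminus>V\<close>, \<open>\<plusminus>V\<^sup>*\<close> gives \<open>D\<^sub>t(I) = O(t\<^sup>-\<^sup>3)\<close>.
  Hence \<open>\<Theta> - \<Theta>' = (I + t\<Theta>) D\<^sub>t (I + t\<Theta>')\<close> tends to \<open>0\<close> as \<open>t\<close> grows, so it vanishes.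
\<close>

section \<open>Linear maps on matrix spaces\<close>

text \<open>For \<lambda> nonzero put \<open>\<nu> = 1 / \<lambda>\<close>. The hypothesis on
  \<lambda> reads \<open>Re \<nu> \<ge> 1\<close>, and the transform of \<Theta> has the coefficient
  \<open>1 / (t + 1)\<close> on the diagonal and \<open>1 / (t + \<nu>)\<close> in the corner. Now
  \<open>1 / (t + 1 / c)\<close> dominates the modulus of the latter for all
  \<open>t \<ge> 0\<close> exactly when \<open>1 / c \<le> Re \<nu>\<close>; the smallest admissible
  \<open>c\<close> is therefore the one of the overview.

  In the converse the obstacle is that the diagonal maps of \<Theta>' are arbitrary: only positivity
  of transforms is known about them. The shared corner determines the off-diagonal blocks of both
  transforms, so these cancel in the difference. At a null vector of a test matrix the transform of
  \<Theta> takes the value \<open>2 (1 / (t + 1) - Re (1 / (t + \<nu>)))\<close>, and for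
  \<open>Re \<nu> = 1\<close> the terms of order \<open>t^-2\<close> cancel. The remaining order
  \<open>t^-3\<close> is just enough, because recovering \<open>\<Theta> - \<Theta>'\<close> costs
  one factor \<open>t\<close> on either side of the difference.\<close>

lemma linear_endo_inj_imp_surj:
  assumes lm: "linear_map K V V T" and fd: "vectorspace.fin_dim K V" and inj: "inj_on T (carrier V)"
  shows "T ` carrier V = carrier V"
proof -
  interpret linear_map K V V T by fact
  have sub: "VectorSpace.subspace K imT V" by (rule imT_is_subspace)
  interpret I: vectorspace K "V.vs imT" using V.subspace_is_vs[OF sub] .
  have dim: "I.dim = V.dim"
    using rank_nullity[OF fd] inj_imp_dim_ker0[OF inj] by simp
  have I_fd: "I.fin_dim"
  proof -
    have "T \<in> LinearCombinations.module_hom K V (V.vs imT)"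
      using f_hom unfolding LinearCombinations.module_hom_def im_def by auto
    then interpret L: linear_map K V "V.vs imT" T
      by unfold_locales
    show ?thesis using L.surj_fin_dim[OF fd] by (simp add: im_def)
  qed
  obtain C where C: "finite C" "I.basis C" using I.finite_basis_exists[OF I_fd] by blast
  have CV: "C \<subseteq> imT" using C(2) unfolding I.basis_def by auto
  \<comment> \<open>A basis of the image already has as many elements as the dimension of the whole
    space, so it is a basis of that space too.\<close>
  have "V.basis C"
  proof (rule V.dim_li_is_basis[OF fd C(1)])
    show "C \<subseteq> carrier V" using CV sub unfolding VectorSpace.subspace_def submodule_def by blast
    show "LinearCombinations.module.lin_indpt K V C" 
      using C(2) V.module.span_li_not_depend(2)[OF CV] sub unfolding I.basis_def VectorSpace.subspace_def by auto
    show "V.dim \<le> card C" using I.dim_basis[OF C] dim by simp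
  qed
  then have "LinearCombinations.module.span K V C = carrier V" unfolding V.basis_def by simp
  moreover have "LinearCombinations.module.span K V C \<subseteq> imT"
    using V.module.span_is_subset[OF CV] sub unfolding VectorSpace.subspace_def by auto
  moreover have "imT \<subseteq> carrier V" using sub unfolding VectorSpace.subspace_def submodule_def by auto
  ultimately show ?thesis unfolding im_def by auto
qed

lemma linear_on_mats_iff:
  "linear_on_mats p q f \<longleftrightarrow>
     (\<forall>A\<in>carrier_mat p q. f A \<in> carrier_mat p q) \<and>
     (\<forall>A\<in>carrier_mat p q. \<forall>B\<in>carrier_mat p q. f (A + B) = f A + f B) \<and>
     (\<forall>c. \<forall>A\<in>carrier_mat p q. f (c \<cdot>\<^sub>m A) = c \<cdot>\<^sub>m f A)"
proof -
  interpret V: vectorspace "class_ring :: complex ring" "module_mat TYPE(complex) p q" by (rule matrix_vs)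
  show ?thesis
    unfolding linear_map_def mod_hom_def mod_hom_axioms_def LinearCombinations.module_hom_def
    using V.vectorspace_axioms V.module_axioms
    by (auto simp: matrix_vs_simps)
qed

lemma index_pair_less:
  fixes i j m r :: nat
  assumes "i < r" "j < m"
  shows "i * m + j < r * m"
proof -
  have "i * m + j < Suc i * m" using assms by simp
  also have "\<dots> \<le> r * m" using assms by (intro mult_le_mono1) simp
  finally show ?thesis .
qed

text \<open>Row-major flattening gives a linear map from vectors of length \<open>m * m\<close> onto
  the matrices, and a linear image of a finite-dimensional space is finite-dimensional.\<close>

lemma fin_dim_mats: "vectorspace.fin_dim (class_ring :: complex ring) (module_mat TYPE(complex) m m)"
proof -
  interpret V: vec_space "TYPE(complex)" "m * m" .
  interpret W: vectorspace "class_ring :: complex ring" "module_mat TYPE(complex) m m" by (rule matrix_vs)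
  define T where "T v = mat m m (\<lambda>(i,j). v $ (i * m + j))" for v :: "complex vec"
  have "linear_map class_ring (module_vec TYPE(complex) (m*m)) (module_mat TYPE(complex) m m) T"
    unfolding linear_map_def mod_hom_def mod_hom_axioms_def LinearCombinations.module_hom_def
    using V.vectorspace_axioms V.module_axioms W.vectorspace_axioms W.module_axioms
    by (auto simp: matrix_vs_simps module_vec_simps T_def index_pair_less intro!: eq_matI)
  then interpret linear_map "class_ring :: complex ring" "module_vec TYPE(complex) (m*m)" "module_mat TYPE(complex) m m" T .
  have "A \<in> T ` carrier_vec (m * m)" if "A \<in> carrier_mat m m" for A
  proof
    show "A = T (vec (m*m) (\<lambda>p. A $$ (p div m, p mod m)))"
      using that by (auto simp: T_def index_pair_less intro!: eq_matI)
  qed auto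
  then have "T ` carrier (module_vec TYPE(complex) (m*m)) = carrier (module_mat TYPE(complex) m m)"
    by (auto simp: matrix_vs_simps module_vec_simps T_def)
  from surj_fin_dim[OF V.fin_dim this] show ?thesis .
qed

section \<open>Positive semidefinite kernels\<close>

text \<open>Kernels on an index set instead of matrices, so that one notion serves matrices, their
  blocks and ampliations. The order on \<open>complex\<close> also makes the form real, so on a
  finite set a kernel of this kind is Hermitian.\<close>

definition psd_on :: "'a set \<Rightarrow> ('a \<Rightarrow> 'a \<Rightarrow> complex) \<Rightarrow> bool" where
  "psd_on S f \<longleftrightarrow> (\<forall>w. 0 \<le> (\<Sum>i\<in>S. \<Sum>j\<in>S. cnj (w i) * f i j * w j))"

lemma psd_onD: "psd_on S f \<Longrightarrow> 0 \<le> (\<Sum>i\<in>S. \<Sum>j\<in>S. cnj (w i) * f i j * w j)"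
  by (simp add: psd_on_def)

lemma psd_on_cong:
  assumes "\<And>i j. i \<in> S \<Longrightarrow> j \<in> S \<Longrightarrow> f i j = g i j"
  shows "psd_on S f \<longleftrightarrow> psd_on S g"
  unfolding psd_on_def using assms by (simp cong: sum.cong)

lemma psd_on_add: "psd_on S f \<Longrightarrow> psd_on S g \<Longrightarrow> psd_on S (\<lambda>i j. f i j + g i j)"
  unfolding psd_on_def by (simp add: algebra_simps sum.distrib)

lemma psd_on_scale: 
  assumes "psd_on S f" "0 \<le> c"
  shows "psd_on S (\<lambda>i j. c * f i j)"
  unfolding psd_on_def
proof
  fix w
  have "(\<Sum>i\<in>S. \<Sum>j\<in>S. cnj (w i) * (c * f i j) * w j) = c * (\<Sum>i\<in>S. \<Sum>j\<in>S. cnj (w i) * f i j * w j)"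
    by (simp add: sum_distrib_left mult_ac)
  then show "0 \<le> (\<Sum>i\<in>S. \<Sum>j\<in>S. cnj (w i) * (c * f i j) * w j)"
    using psd_onD[OF assms(1)] assms(2) by simp
qed

lemma psd_on_sum:
  assumes "\<And>l. l \<in> L \<Longrightarrow> psd_on S (f l)"
  shows "psd_on S (\<lambda>i j. \<Sum>l\<in>L. f l i j)"
  using assms
proof (induction L rule: infinite_finite_induct)
  case (insert x F)
  then show ?case using psd_on_add[of S "f x" "\<lambda>i j. \<Sum>l\<in>F. f l i j"] by simp
qed (auto simp: psd_on_def)

lemma psd_on_pullback:
  assumes "psd_on T f"
  shows "psd_on S (\<lambda>i j. \<Sum>p\<in>T. \<Sum>q\<in>T. M i p * f p q * cnj (M j q))"
  unfolding psd_on_def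
proof
  fix w
  \<comment> \<open>\<open>y\<close> is the adjoint of \<open>M\<close> applied to \<open>w\<close>:
    the form of \<open>M f M\<^sup>*\<close> at \<open>w\<close> is the form of \<open>f\<close> at
    \<open>y\<close>.\<close>
  define y where "y = (\<lambda>p. \<Sum>i\<in>S. cnj (M i p) * w i)"
  have "(\<Sum>i\<in>S. \<Sum>j\<in>S. cnj (w i) * (\<Sum>p\<in>T. \<Sum>q\<in>T. M i p * f p q * cnj (M j q)) * w j)
     = (\<Sum>i\<in>S. \<Sum>j\<in>S. \<Sum>p\<in>T. \<Sum>q\<in>T. cnj (w i) * M i p * f p q * cnj (M j q) * w j)"
    by (simp add: sum_distrib_left sum_distrib_right mult_ac)
  also have "\<dots> = (\<Sum>i\<in>S. \<Sum>p\<in>T. \<Sum>j\<in>S. \<Sum>q\<in>T. cnj (w i) * M i p * f p q * cnj (M j q) * w j)"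
    by (intro sum.cong refl sum.swap)
  also have "\<dots> = (\<Sum>i\<in>S. \<Sum>p\<in>T. \<Sum>q\<in>T. \<Sum>j\<in>S. cnj (w i) * M i p * f p q * cnj (M j q) * w j)"
    by (intro sum.cong refl sum.swap)
  also have "\<dots> = (\<Sum>p\<in>T. \<Sum>i\<in>S. \<Sum>q\<in>T. \<Sum>j\<in>S. cnj (w i) * M i p * f p q * cnj (M j q) * w j)"
    by (rule sum.swap)
  also have "\<dots> = (\<Sum>p\<in>T. \<Sum>q\<in>T. \<Sum>i\<in>S. \<Sum>j\<in>S. cnj (w i) * M i p * f p q * cnj (M j q) * w j)"
    by (intro sum.cong refl sum.swap)
  also have "\<dots> = (\<Sum>p\<in>T. \<Sum>q\<in>T. cnj (y p) * f p q * y q)"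
    unfolding y_def
    by (simp add: sum_distrib_left sum_distrib_right mult_ac)
  finally show "0 \<le> (\<Sum>i\<in>S. \<Sum>j\<in>S. cnj (w i) * (\<Sum>p\<in>T. \<Sum>q\<in>T. M i p * f p q * cnj (M j q)) * w j)"
    using psd_onD[OF assms, of y] by simp
qed

lemma psd_on_rank_one: "psd_on S (\<lambda>i j. g i * cnj (g j))"
proof -
  have "psd_on {()} (\<lambda>_ _. 1)"
    unfolding psd_on_def by (simp add: mult.commute[of "cnj _"] complex_norm_square[symmetric] less_eq_complex_def power2_eq_square)
  from psd_on_pullback[OF this, of S "\<lambda>i _. g i"] show ?thesis by simp
qed

lemma psd_on_congruence:
  assumes "psd_on S f"
  shows "psd_on S (\<lambda>i j. g i * f i j * cnj (g j))"
  unfolding psd_on_def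
proof
  fix w
  show "0 \<le> (\<Sum>i\<in>S. \<Sum>j\<in>S. cnj (w i) * (g i * f i j * cnj (g j)) * w j)"
    using psd_onD[OF assms, of "\<lambda>i. cnj (g i) * w i"] by (simp add: mult_ac)
qed

lemma psd_on_subset:
  assumes f: "psd_on S f" and T: "T \<subseteq> S" and S: "finite S"
  shows "psd_on T f"
  unfolding psd_on_def
proof
  fix w :: "'a \<Rightarrow> complex"
  define v :: "'a \<Rightarrow> complex" where "v i = (if i \<in> T then w i else 0)" for i
  have "(\<Sum>i\<in>S. \<Sum>j\<in>S. cnj (v i) * f i j * v j) = (\<Sum>i\<in>T. \<Sum>j\<in>S. cnj (v i) * f i j * v j)"
    using S T by (intro sum.mono_neutral_right) (auto simp: v_def)
  also have "\<dots> = (\<Sum>i\<in>T. \<Sum>j\<in>T. cnj (v i) * f i j * v j)"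
    using S T by (intro sum.cong refl sum.mono_neutral_right) (auto simp: v_def)
  also have "\<dots> = (\<Sum>i\<in>T. \<Sum>j\<in>T. cnj (w i) * f i j * w j)"
    by (simp add: v_def)
  finally show "0 \<le> (\<Sum>i\<in>T. \<Sum>j\<in>T. cnj (w i) * f i j * w j)"
    using psd_onD[OF f, of v] by simp
qed

lemma psd_on_diag:
  assumes "psd_on S f" "finite S" "i \<in> S"
  shows "0 \<le> f i i"
  using psd_onD[OF psd_on_subset[OF assms(1) _ assms(2), of "{i}"], of "\<lambda>_. 1"] assms(3) by simp

lemma psd_on_pair:
  assumes "psd_on S f" "finite S" "i \<in> S" "j \<in> S" "i \<noteq> j"
  shows "0 \<le> cnj a * f i i * a + cnj a * f i j * b + cnj b * f j i * a + cnj b * f j j * b"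
  using psd_onD[OF psd_on_subset[OF assms(1) _ assms(2), of "{i,j}"], of "\<lambda>x. if x = i then a else b"] assms(3-5) 
  by (simp add: add_ac)

text \<open>Polarization: the form is real, so the test vectors \<open>(1, 1)\<close> and
  \<open>(1, \<i>)\<close> kill the imaginary part of \<open>f i j + f j i\<close> and the real part
  of \<open>f i j - f j i\<close>.\<close>

lemma psd_on_hermitian:
  assumes "psd_on S f" "finite S" "i \<in> S" "j \<in> S"
  shows "f j i = cnj (f i j)"
proof (cases "i = j")
  case True
  then show ?thesis using psd_on_diag[OF assms(1-3)] by (simp add: complex_eq_iff less_eq_complex_def)
next
  case False
  have "0 \<le> f i i" "0 \<le> f j j" using psd_on_diag assms by metis+
  with psd_on_pair[OF assms False, of 1 1] psd_on_pair[OF assms False, of 1 "\<i>"] show ?thesis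
    by (simp add: complex_eq_iff less_eq_complex_def)
qed

text \<open>The test vector is \<open>(1, b)\<close> with the unimodular \<open>b\<close> that turns
  \<open>f i j\<close> into \<open>- cmod (f i j)\<close>. Bounding by the arithmetic mean of the
  diagonal keeps the later estimates linear in the diagonal.\<close>

lemma psd_on_entry_bound:
  assumes "psd_on S f" "finite S" "i \<in> S" "j \<in> S"
  shows "2 * cmod (f i j) \<le> Re (f i i) + Re (f j j)"
proof (cases "i = j \<or> f i j = 0")
  case True
  then show ?thesis using psd_on_diag[OF assms(1-3)] psd_on_diag[OF assms(1-2) assms(4)]
    by (auto simp: less_eq_complex_def cmod_eq_Re)
next
  case False
  define b where "b = - cnj (f i j) / cmod (f i j)"
  have b1: "cnj b * b = 1" "b * cnj b = 1" using False by (auto simp: b_def complex_norm_square[symmetric] power2_eq_square mult.commute[of "cnj _"])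
  have fb: "f i j * b = - complex_of_real (cmod (f i j))"
    using False by (simp add: b_def complex_norm_square[symmetric] power2_eq_square)
  then have fb': "cnj b * cnj (f i j) = - complex_of_real (cmod (f i j))"
    by (metis complex_cnj_complex_of_real complex_cnj_minus complex_cnj_mult mult.commute)
  have "0 \<le> f i i + f i j * b + cnj b * f j i + (cnj b * b) * f j j"
    using psd_on_pair[OF assms, of 1 b] False by (simp add: mult_ac)
  then have "0 \<le> f i i - complex_of_real (cmod (f i j)) - complex_of_real (cmod (f i j)) + f j j"
    using fb fb' b1 psd_on_hermitian[OF assms] by simp
  then show ?thesis by (simp add: less_eq_complex_def)
qed

lemma psd_on_zero_diag:
  assumes "psd_on S f" "finite S" "i \<in> S" "j \<in> S" "f i i = 0"
  shows "f i j = 0"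
proof (cases "i = j")
  case False
  define r where "r = (cmod (f i j))\<^sup>2"
  \<comment> \<open>At the test vector \<open>(x, - cnj (f i j))\<close> the form is
    \<open>r * (Re (f j j) - 2 * x)\<close>; this \<open>x\<close> makes the second factor negative,
    which forces \<open>r = 0\<close>.\<close>
  define x where "x = Re (f j j) + 1"
  have h: "f j i = cnj (f i j)" by (rule psd_on_hermitian[OF assms(1-4)])
  have fr: "f i j * cnj (f i j) = of_real r" by (simp add: r_def complex_norm_square[symmetric])
  have fj: "f j j = of_real (Re (f j j))"
    using psd_on_diag[OF assms(1,2,4)] by (simp add: complex_eq_iff less_eq_complex_def)
  have "0 \<le> - (complex_of_real x * (f i j * cnj (f i j))) - complex_of_real x * (f i j * cnj (f i j)) + (f i j * cnj (f i j)) * f j j"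
    using psd_on_pair[OF assms(1-4) False, of "of_real x" "- cnj (f i j)"] assms(5) h by (simp add: mult_ac)
  then have "0 \<le> complex_of_real (- x * r - x * r + r * Re (f j j))"
    unfolding fr by (subst (asm) fj) simp
  then have "0 \<le> - x * r - x * r + r * Re (f j j)" 
    by (simp add: less_eq_complex_def)
  then have "0 \<le> r * (- Re (f j j) - 2)" by (simp add: x_def algebra_simps)
  moreover have "Re (f j j) \<ge> 0" using psd_on_diag[OF assms(1,2,4)] by (simp add: less_eq_complex_def)
  moreover have "r \<ge> 0" by (simp add: r_def)
  ultimately have "r = 0" by (simp add: zero_le_mult_iff)
  then show ?thesis by (simp add: r_def)
qed (use assms in simp)

text \<open>Induction on the index set, splitting off one row and column by a Schur complement.\<close>

lemma psd_on_gram: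
  assumes "finite S" "psd_on S f"
  shows "\<exists>(N::nat) K. \<forall>i\<in>S. \<forall>j\<in>S. f i j = (\<Sum>l<N. K l i * cnj (K l j))"
  using assms
proof (induction S arbitrary: f rule: finite_induct)
  case empty
  then show ?case by simp
next
  case (insert x S)
  have fin: "finite (insert x S)" using insert by simp
  have herm: "f j i = cnj (f i j)" if "i \<in> insert x S" "j \<in> insert x S" for i j
    using psd_on_hermitian[OF insert.prems fin that] .
  show ?case
  proof (cases "f x x = 0")
    case True
    have z: "f x j = 0" "f j x = 0" if "j \<in> insert x S" for j
      using psd_on_zero_diag[OF insert.prems fin _ that True] herm[of x j] that by auto
    obtain N :: nat and K where K: "\<forall>i\<in>S. \<forall>j\<in>S. f i j = (\<Sum>l<N. K l i * cnj (K l j))"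
      using insert.IH[OF psd_on_subset[OF insert.prems _ fin]] by blast
    have "f i j = (\<Sum>l<N. (if i = x then 0 else K l i) * cnj (if j = x then 0 else K l j))"
      if "i \<in> insert x S" "j \<in> insert x S" for i j
      using K z that by (cases "i = x \<or> j = x") auto
    then show ?thesis by (intro exI[of _ N] exI[of _ "\<lambda>l i. if i = x then 0 else K l i"]) blast
  next
    case False
    define d where "d = Re (f x x)"
    have fd: "f x x = of_real d" and d: "d > 0"
      using psd_on_diag[OF insert.prems fin, of x] False 
      by (auto simp: d_def complex_eq_iff less_eq_complex_def)
    define g where "g i j = f i j - f i x * f x j / d" for i j
    have "psd_on S g"
      unfolding psd_on_def
    proof
      fix w
      define s where "s = (\<Sum>j\<in>S. f x j * w j)"
      \<comment> \<open>The coordinate at \<open>x\<close> minimizes the form for given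
        \<open>w\<close> on \<open>S\<close>; completing the square leaves the form of the Schur
        complement \<open>g\<close>.\<close>
      define v where "v = (\<lambda>i. if i = x then - s / d else w i)"
      have cs: "cnj s = (\<Sum>i\<in>S. cnj (w i) * f i x)"
        unfolding s_def by (simp add: herm[of x] mult.commute)
      have vS: "(\<Sum>j\<in>S. F j (v j)) = (\<Sum>j\<in>S. F j (w j))" for F :: "'a \<Rightarrow> complex \<Rightarrow> complex"
        using insert.hyps by (intro sum.cong) (auto simp: v_def)
      have "(\<Sum>i\<in>insert x S. \<Sum>j\<in>insert x S. cnj (v i) * f i j * v j)
        = cnj (v x) * f x x * v x + (\<Sum>j\<in>S. cnj (v x) * f x j * v j)
          + (\<Sum>i\<in>S. cnj (v i) * f i x * v x + (\<Sum>j\<in>S. cnj (v i) * f i j * v j))"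
        using insert.hyps by simp
      also have "\<dots> = cnj (v x) * f x x * v x + (\<Sum>j\<in>S. cnj (v x) * f x j * w j)
          + (\<Sum>i\<in>S. cnj (w i) * f i x * v x + (\<Sum>j\<in>S. cnj (w i) * f i j * w j))"
        by (simp add: vS[of "\<lambda>j y. _ j * y"] vS[of "\<lambda>i y. cnj y * f i x * v x + (\<Sum>j\<in>S. cnj y * f i j * w j)"])
      also have "\<dots> = cnj (v x) * f x x * v x + cnj (v x) * s + cnj s * v x
          + (\<Sum>i\<in>S. \<Sum>j\<in>S. cnj (w i) * f i j * w j)"
        unfolding cs unfolding s_def by (simp add: sum.distrib sum_distrib_left sum_distrib_right mult_ac)
      also have "\<dots> = (\<Sum>i\<in>S. \<Sum>j\<in>S. cnj (w i) * f i j * w j) - cnj s * s / d"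
        using d by (simp add: fd v_def field_simps)
      also have "\<dots> = (\<Sum>i\<in>S. \<Sum>j\<in>S. cnj (w i) * g i j * w j)"
        unfolding cs unfolding s_def g_def
        by (simp add: algebra_simps sum_subtractf sum_distrib_left sum_distrib_right sum_divide_distrib)
      finally show "0 \<le> (\<Sum>i\<in>S. \<Sum>j\<in>S. cnj (w i) * g i j * w j)"
        using psd_onD[OF insert.prems, of v] by simp
    qed
    then obtain N :: nat and K where K: "\<forall>i\<in>S. \<forall>j\<in>S. g i j = (\<Sum>l<N. K l i * cnj (K l j))"
      using insert.IH by blast
    \<comment> \<open>The vectors of the induction hypothesis are set to zero at \<open>x\<close>;
      the extra one, with index \<open>N\<close>, is the pivot column divided by the root of the
      pivot.\<close>
    define K' where "K' l i = (if l < N then if i = x then 0 else K l i else f i x / sqrt d)" for l i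
    have last: "K' N i * cnj (K' N j) = f i x * f x j / d" if "j \<in> insert x S" for i j
      using d herm[of j x] that
      by (simp add: K'_def flip: of_real_mult)
    have "f i j = (\<Sum>l<Suc N. K' l i * cnj (K' l j))" if ij: "i \<in> insert x S" "j \<in> insert x S" for i j
    proof (cases "i = x \<or> j = x")
      case True
      then have "(\<Sum>l<N. K' l i * cnj (K' l j)) = 0" by (intro sum.neutral) (auto simp: K'_def)
      then show ?thesis using last[OF ij(2), of i] True d fd by auto
    next
      case False
      then have "(\<Sum>l<N. K' l i * cnj (K' l j)) = g i j"
        using K ij by (simp add: K'_def)
      then show ?thesis using last[OF ij(2), of i] by (simp add: g_def)
    qed
    then show ?thesis by blast
  qed
qed

section \<open>Completely positive maps\<close>

lemma sum_lessThan_add: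
  fixes n m :: nat
  shows "(\<Sum>i<n + m. F i) = (\<Sum>i<n. F i) + (\<Sum>i<m. F (n + i))"
  by (induction m) (simp_all add: add_ac)

lemma double_sum_lessThan_add:
  fixes n m :: nat
  shows "(\<Sum>i<n + m. \<Sum>j<n + m. F i j) =
    (\<Sum>i<n. \<Sum>j<n. F i j) + (\<Sum>i<n. \<Sum>j<m. F i (n + j))
    + (\<Sum>i<m. \<Sum>j<n. F (n + i) j) + (\<Sum>i<m. \<Sum>j<m. F (n + i) (n + j))"
  by (simp only: sum_lessThan_add sum.distrib add.assoc add.left_commute)

lemma mat_adjoint_dim [simp]:
  "dim_row (mat_adjoint A) = dim_col A" "dim_col (mat_adjoint A) = dim_row A"
  by (simp_all add: mat_adjoint_def)

lemma mat_adjoint_index [simp]: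
  "i < dim_col A \<Longrightarrow> j < dim_row A \<Longrightarrow> mat_adjoint A $$ (i, j) = cnj ((A :: complex mat) $$ (j, i))"
  by (simp add: mat_adjoint_def mat_of_rows_def conjugate_vec_def)

lemma sum_if_div:
  fixes r m :: nat
  assumes "\<alpha> < r"
  shows "(\<Sum>p<r * m. if p div m = \<alpha> then G p else 0) = (\<Sum>a<m. G (\<alpha> * m + a))"
proof -
  have "(\<Sum>p<r * m. if p div m = \<alpha> then G p else 0) = sum G {p \<in> {..<r*m}. p div m = \<alpha>}"
    by (rule sum.inter_filter[symmetric]) simp
  also have "{p \<in> {..<r*m}. p div m = \<alpha>} = (\<lambda>a. \<alpha> * m + a) ` {..<m}"
  proof (intro equalityI subsetI)
    fix p assume p: "p \<in> {p \<in> {..<r*m}. p div m = \<alpha>}"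
    then have "m > 0" by (cases m) auto
    then have "p = \<alpha> * m + p mod m" "p mod m < m" using p by auto
    then show "p \<in> (\<lambda>a. \<alpha> * m + a) ` {..<m}" by blast
  qed (use index_pair_less assms in auto)
  also have "sum G \<dots> = (\<Sum>a<m. G (\<alpha> * m + a))"
    by (simp add: sum.reindex)
  finally show ?thesis .
qed

lemma positive_mat_iff_psd_on:
  "positive_mat m A \<longleftrightarrow> A \<in> carrier_mat m m \<and> psd_on {..<m} (\<lambda>i j. A $$ (i, j))"
proof (cases "A \<in> carrier_mat m m")
  case True
  have *: "(A *\<^sub>v v) \<bullet>c v = (\<Sum>i<m. \<Sum>j<m. cnj (v $ i) * A $$ (i, j) * v $ j)" if "v \<in> carrier_vec m" for v
    using True that by (auto simp: scalar_prod_def sum_distrib_right sum_distrib_left mult_ac atLeast0LessThan intro!: sum.cong)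
  have "(\<forall>v\<in>carrier_vec m. 0 \<le> (A *\<^sub>v v) \<bullet>c v) \<longleftrightarrow> psd_on {..<m} (\<lambda>i j. A $$ (i, j))"
  proof
    assume L: "\<forall>v\<in>carrier_vec m. 0 \<le> (A *\<^sub>v v) \<bullet>c v"
    show "psd_on {..<m} (\<lambda>i j. A $$ (i, j))"
      unfolding psd_on_def
    proof
      fix w
      show "0 \<le> (\<Sum>i<m. \<Sum>j<m. cnj (w i) * A $$ (i, j) * w j)"
        using L[rule_format, of "vec m w"] *[of "vec m w"] by simp
    qed
  next
    assume R: "psd_on {..<m} (\<lambda>i j. A $$ (i, j))"
    show "\<forall>v\<in>carrier_vec m. 0 \<le> (A *\<^sub>v v) \<bullet>c v"
      using psd_onD[OF R] * by simp
  qed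
  then show ?thesis using True by (simp add: positive_mat_def)
qed (simp add: positive_mat_def)

text \<open>A Schur product in Kraus form: with a Gram decomposition
  \<open>W i j = (\<Sum>s<N. g s i * cnj (g s j))\<close> the map becomes a nonnegative combination
  of maps \<open>A \<mapsto> K A K\<^sup>*\<close> with
  \<open>K i a = g s i * \<kappa> l i a\<close>.\<close>

lemma completely_positiveI:
  fixes c :: "'l \<Rightarrow> real" and \<kappa> :: "'l \<Rightarrow> nat \<Rightarrow> nat \<Rightarrow> complex"
  assumes carr: "\<And>A. A \<in> carrier_mat m m \<Longrightarrow> f A \<in> carrier_mat m m"
    and W: "psd_on {..<m} W"
    and c: "\<And>l. l \<in> L \<Longrightarrow> 0 \<le> c l"
    and f: "\<And>A i j. A \<in> carrier_mat m m \<Longrightarrow> i < m \<Longrightarrow> j < m \<Longrightarrow>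
      f A $$ (i, j) = W i j * (\<Sum>l\<in>L. of_real (c l) * (\<Sum>a<m. \<Sum>b<m. \<kappa> l i a * A $$ (a, b) * cnj (\<kappa> l j b)))"
  shows "completely_positive m f"
proof -
  have "linear_on_mats m m f"
    unfolding linear_on_mats_iff
  proof (intro conjI ballI allI)
    fix A B :: "complex mat" assume AB: "A \<in> carrier_mat m m" "B \<in> carrier_mat m m"
    note AB' = carrier_matD[OF carr[OF AB(1)]] carrier_matD[OF carr[OF AB(2)]]  carrier_matD[OF carr[of "A+B"]] AB
    show "f (A + B) = f A + f B"
      using AB' by (intro eq_matI) (auto simp: f algebra_simps sum.distrib)
  next
    fix A :: "complex mat" and x assume A: "A \<in> carrier_mat m m"
    note A' = carrier_matD[OF carr[OF A]] carrier_matD[OF carr[of "x \<cdot>\<^sub>m A"]] A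
    show "f (x \<cdot>\<^sub>m A) = x \<cdot>\<^sub>m f A"
      using A' by (intro eq_matI) (auto simp: f sum_distrib_left mult_ac)
  qed (rule carr)
  moreover have "positive_mat (r * m) (ampliation r m f A)" if A: "positive_mat (r * m) A" for r A
  proof -
    have psdA: "psd_on {..<r * m} (\<lambda>i j. A $$ (i, j))" and cA: "A \<in> carrier_mat (r * m) (r * m)"
      using A by (auto simp: positive_mat_iff_psd_on)
    obtain N :: nat and g where g: "\<forall>i\<in>{..<m}. \<forall>j\<in>{..<m}. W i j = (\<Sum>s<N. g s i * cnj (g s j))"
      using psd_on_gram[OF _ W] by auto
    \<comment> \<open>\<open>M s l\<close> is a Kraus operator tensored with the identity of size
      \<open>r\<close>: an index splits into the block number \<open>I div m\<close> and the
      position \<open>I mod m\<close>, and different blocks are not mixed.\<close>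
    define M where "M s l I p = (if p div m = I div m then g s (I mod m) * \<kappa> l (I mod m) (p mod m) else 0)" for s l I p
    define Q where "Q s l I J = (\<Sum>p<r*m. \<Sum>q<r*m. M s l I p * A $$ (p, q) * cnj (M s l J q))" for s l I J
    have "psd_on {..<r*m} (\<lambda>I J. \<Sum>s<N. \<Sum>l\<in>L. of_real (c l) * Q s l I J)"
      unfolding Q_def using c by (intro psd_on_sum psd_on_scale psd_on_pullback psdA) (simp add: less_eq_complex_def)
    also have "?this \<longleftrightarrow> psd_on {..<r*m} (\<lambda>i j. ampliation r m f A $$ (i, j))"
    proof (rule psd_on_cong)
      fix I J assume IJ: "I \<in> {..<r*m}" "J \<in> {..<r*m}"
      then have "m > 0" by (cases m) auto
      then have lt: "I div m < r" "J div m < r" "I mod m < m" "J mod m < m"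
        using IJ by (auto simp: less_mult_imp_div_less)
      define \<alpha> i \<beta> j where "\<alpha> = I div m" "i = I mod m" "\<beta> = J div m" "j = J mod m"
      have Q: "Q s l I J = (\<Sum>a<m. \<Sum>b<m. g s i * \<kappa> l i a * A $$ (\<alpha> * m + a, \<beta> * m + b) * cnj (g s j * \<kappa> l j b))" for s l
      proof -
        have "Q s l I J = (\<Sum>p<r*m. if p div m = \<alpha> then \<Sum>q<r*m. if q div m = \<beta> then 
            g s i * \<kappa> l i (p mod m) * A $$ (p, q) * cnj (g s j * \<kappa> l j (q mod m)) else 0 else 0)"
          unfolding Q_def M_def \<alpha>_i_\<beta>_j_def by (intro sum.cong refl) (auto intro!: sum.cong sum.neutral)
        also have "\<dots> = (\<Sum>a<m. \<Sum>b<m. g s i * \<kappa> l i ((\<alpha> * m + a) mod m) * A $$ (\<alpha> * m + a, \<beta> * m + b) * cnj (g s j * \<kappa> l j ((\<beta> * m + b) mod m)))"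
          using lt unfolding \<alpha>_i_\<beta>_j_def[symmetric] by (simp only: sum_if_div)
        also have "\<dots> = (\<Sum>a<m. \<Sum>b<m. g s i * \<kappa> l i a * A $$ (\<alpha> * m + a, \<beta> * m + b) * cnj (g s j * \<kappa> l j b))"
          by (intro sum.cong refl) simp
        finally show ?thesis .
      qed
      have "ampliation r m f A $$ (I, J) = W i j * (\<Sum>l\<in>L. of_real (c l) * (\<Sum>a<m. \<Sum>b<m. \<kappa> l i a * A $$ (\<alpha> * m + a, \<beta> * m + b) * cnj (\<kappa> l j b)))"
        using IJ lt unfolding ampliation_def \<alpha>_i_\<beta>_j_def by (simp add: f)
      also have "W i j = (\<Sum>s<N. g s i * cnj (g s j))" using g lt by (simp add: \<alpha>_i_\<beta>_j_def)
      finally show "(\<Sum>s<N. \<Sum>l\<in>L. of_real (c l) * Q s l I J) = ampliation r m f A $$ (I, J)"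
        unfolding Q sum_product by (simp add: sum_distrib_left mult_ac)
    qed
    finally show ?thesis by (simp add: positive_mat_iff_psd_on ampliation_def)
  qed
  ultimately show ?thesis by (simp add: completely_positive_def)
qed

text \<open>Two-positivity is applied to the positive block matrix with diagonal blocks \<open>c I\<close> and corner \<open>N\<close>.\<close>

lemma completely_positive_entry_bound:
  assumes D: "completely_positive m D" and N: "N \<in> carrier_mat m m"
    and i: "i < m" and j: "j < m"
  defines "c \<equiv> \<Sum>a<m. \<Sum>b<m. cmod (N $$ (a, b))"
  shows "2 * cmod (D N $$ (i, j)) \<le> c * (Re (D (1\<^sub>m m) $$ (i, i)) + Re (D (1\<^sub>m m) $$ (j, j)))"
proof -
  \<comment> \<open>\<open>c\<close> bounds the operator norm of \<open>N\<close> crudely, by the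
    sum of the moduli of its entries; this already makes \<open>B\<close> positive, without singular
    values.\<close>
  define B where "B = four_block_mat (of_real c \<cdot>\<^sub>m 1\<^sub>m m) N (mat_adjoint N) (of_real c \<cdot>\<^sub>m 1\<^sub>m m)"
  have lin: "linear_on_mats m m D" using D by (simp add: completely_positive_def)
  note lin' = lin[unfolded linear_on_mats_iff]
  have "psd_on {..<2 * m} (\<lambda>i j. B $$ (i, j))"
    unfolding psd_on_def
  proof
    fix w :: "nat \<Rightarrow> complex"
    define u where "u i = w i" for i
    define v where "v i = w (m + i)" for i
    define z where "z = (\<Sum>i<m. \<Sum>j<m. cnj (u i) * N $$ (i, j) * v j)"
    have "(\<Sum>i<2*m. \<Sum>j<2*m. cnj (w i) * B $$ (i, j) * w j) = 
      (\<Sum>i<m. \<Sum>j<m. cnj (u i) * (if i = j then of_real c else 0) * u j)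
      + (\<Sum>i<m. \<Sum>j<m. cnj (u i) * N $$ (i, j) * v j)
      + (\<Sum>i<m. \<Sum>j<m. cnj (v i) * cnj (N $$ (j, i)) * u j)
      + (\<Sum>i<m. \<Sum>j<m. cnj (v i) * (if i = j then of_real c else 0) * v j)"
    proof -
      have B: "B $$ (i, j) = (if i = j then of_real c else 0)" "B $$ (i, m + j) = N $$ (i, j)"
        "B $$ (m + i, j) = cnj (N $$ (j, i))" "B $$ (m + i, m + j) = (if i = j then of_real c else 0)"
        if "i < m" "j < m" for i j
        unfolding B_def using N that by auto
      show ?thesis
        unfolding mult_2 double_sum_lessThan_add u_def v_def by (simp add: B)
    qed
    also have "\<dots> = of_real (c * (\<Sum>i<m. (cmod (u i))\<^sup>2) + c * (\<Sum>i<m. (cmod (v i))\<^sup>2) + 2 * Re z)"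
    proof -
      have "(\<Sum>i<m. \<Sum>j<m. cnj (v i) * cnj (N $$ (j, i)) * u j) = cnj z"
        unfolding z_def by (simp add: mult_ac) (rule sum.swap)
      moreover have "(\<Sum>i<m. \<Sum>j<m. cnj (x i) * (if i = j then of_real c else 0) * x j) = of_real (c * (\<Sum>i<m. (cmod (x i))\<^sup>2))" for x :: "nat \<Rightarrow> complex"
      proof -
        have "(\<Sum>i<m. \<Sum>j<m. cnj (x i) * (if i = j then of_real c else 0) * x j) = (\<Sum>i<m. \<Sum>j<m. if i = j then cnj (x i) * of_real c * x j else 0)"
          by (intro sum.cong refl) simp
        also have "\<dots> = (\<Sum>i<m. of_real c * (x i * cnj (x i)))"
          by (simp add: mult_ac)
        finally show ?thesis by (simp add: complex_norm_square[symmetric] sum_distrib_left)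
      qed
      ultimately show ?thesis using complex_add_cnj[of z] by (simp add: z_def[symmetric])
    qed
    finally have eq: "(\<Sum>i<2*m. \<Sum>j<2*m. cnj (w i) * B $$ (i, j) * w j) = of_real (c * (\<Sum>i<m. (cmod (u i))\<^sup>2) + c * (\<Sum>i<m. (cmod (v i))\<^sup>2) + 2 * Re z)" .
    show "0 \<le> (\<Sum>i<2*m. \<Sum>j<2*m. cnj (w i) * B $$ (i, j) * w j)"
    proof -
      define U where "U = (\<Sum>i<m. (cmod (u i))\<^sup>2)"
      define V where "V = (\<Sum>i<m. (cmod (v i))\<^sup>2)"
      have uv: "2 * (cmod (u i) * cmod (v j)) \<le> U + V" if "i < m" "j < m" for i j
      proof -
        have "(cmod (u i))\<^sup>2 \<le> U" "(cmod (v j))\<^sup>2 \<le> V"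
          unfolding U_def V_def using that by (auto intro: member_le_sum)
        then show ?thesis using sum_squares_bound[of "cmod (u i)" "cmod (v j)"] by simp
      qed
      have "cmod z \<le> (\<Sum>i<m. \<Sum>j<m. cmod (N $$ (i, j)) * (cmod (u i) * cmod (v j)))"
        unfolding z_def by (intro sum_norm_le order_trans[OF norm_sum] sum_mono) (simp add: norm_mult mult_ac)
      also have "\<dots> \<le> (\<Sum>i<m. \<Sum>j<m. cmod (N $$ (i, j)) * ((U + V) / 2))"
        using uv by (intro sum_mono mult_left_mono) (auto simp: field_simps)
      also have "\<dots> = c * ((U + V) / 2)" unfolding c_def by (simp add: sum_distrib_right)
      finally have "0 \<le> c * U + c * V + 2 * Re z"
        using abs_Re_le_cmod[of z] by (simp add: field_simps)
      then show ?thesis unfolding eq by (simp add: U_def V_def less_eq_complex_def)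
    qed
  qed
  moreover have "B \<in> carrier_mat (2 * m) (2 * m)"
    unfolding B_def carrier_mat_def by simp
  ultimately have "positive_mat (2 * m) B" by (simp add: positive_mat_iff_psd_on)
  then have "positive_mat (2 * m) (ampliation 2 m D B)"
    using D unfolding completely_positive_def by blast
  then have psd: "psd_on {..<2*m} (\<lambda>i j. ampliation 2 m D B $$ (i, j))"
    by (simp add: positive_mat_iff_psd_on)
  have amp: "ampliation 2 m D B $$ (I, J) =
      D (mat m m (\<lambda>(a, b). B $$ (I div m * m + a, J div m * m + b))) $$ (I mod m, J mod m)"
    if "I < 2 * m" "J < 2 * m" for I J
    using that unfolding ampliation_def by simp
  have b: "mat m m (\<lambda>(a, b). B $$ (0 * m + a, 0 * m + b)) = of_real c \<cdot>\<^sub>m 1\<^sub>m m"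
    "mat m m (\<lambda>(a, b). B $$ (0 * m + a, 1 * m + b)) = N"
    "mat m m (\<lambda>(a, b). B $$ (1 * m + a, 1 * m + b)) = of_real c \<cdot>\<^sub>m 1\<^sub>m m"
    unfolding B_def using N by (auto intro!: eq_matI)
  have div: "(m + j) div m = 1" "i div m = 0" "(m + j) mod m = j" "i mod m = i"
    "i < 2 * m" "m + j < 2 * m" using i j by auto
  have D1: "D (of_real c \<cdot>\<^sub>m 1\<^sub>m m) $$ (l, l) = of_real c * D (1\<^sub>m m) $$ (l, l)" if "l < m" for l
  proof -
    have "D (1\<^sub>m m) \<in> carrier_mat m m" "D (of_real c \<cdot>\<^sub>m 1\<^sub>m m) = of_real c \<cdot>\<^sub>m D (1\<^sub>m m)"
      using lin' by simp_all
    then show ?thesis using that by simp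
  qed
  have e: "ampliation 2 m D B $$ (i, m + j) = D N $$ (i, j)"
    "ampliation 2 m D B $$ (i, i) = of_real c * D (1\<^sub>m m) $$ (i, i)"
    "ampliation 2 m D B $$ (m + j, m + j) = of_real c * D (1\<^sub>m m) $$ (j, j)"
    unfolding amp[OF div(5,6)] amp[OF div(5,5)] amp[OF div(6,6)] div(1-4) b
    using D1 i j by simp_all
  have "2 * cmod (ampliation 2 m D B $$ (i, m + j)) \<le>
      Re (ampliation 2 m D B $$ (i, i)) + Re (ampliation 2 m D B $$ (m + j, m + j))"
    by (rule psd_on_entry_bound[OF psd]) (use div in auto)
  then show ?thesis unfolding e by (simp add: algebra_simps)
qed

lemma completely_positive_imp_positive:
  assumes f: "completely_positive m f" and A: "positive_mat m A"
  shows "positive_mat m (f A)"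
proof -
  have "A \<in> carrier_mat m m" using A by (simp add: positive_mat_def)
  then have A': "mat m m (($$) A) = A" and fA: "f A \<in> carrier_mat m m"
    using f by (auto simp: completely_positive_def linear_on_mats_iff)
  have "positive_mat (1 * m) (ampliation 1 m f A)"
    by (rule f[unfolded completely_positive_def, THEN conjunct2, rule_format]) (simp add: A)
  moreover have "ampliation 1 m f A = f A"
    using fA by (intro eq_matI) (simp_all add: ampliation_def A')
  ultimately show ?thesis by simp
qed

section \<open>Transforms and corner maps\<close>

lemma split_block_eq:
  assumes "M \<in> carrier_mat (n + n') (n + n')"
  shows "split_block M n n =
    (mat n n (\<lambda>(i, j). M $$ (i, j)), mat n n' (\<lambda>(i, j). M $$ (i, n + j)),
     mat n' n (\<lambda>(i, j). M $$ (n + i, j)), mat n' n' (\<lambda>(i, j). M $$ (n + i, n + j)))"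
  using assms by (auto simp: split_block_def Let_def add.commute)

lemma corner_map_eq:
  assumes "M \<in> carrier_mat (n + n') (n + n')"
  shows "corner_map n \<phi> \<gamma> \<psi> M =
    four_block_mat (\<phi> (mat n n (\<lambda>(i, j). M $$ (i, j)))) (\<gamma> (mat n n' (\<lambda>(i, j). M $$ (i, n + j))))
      (mat_adjoint (\<gamma> (mat_adjoint (mat n' n (\<lambda>(i, j). M $$ (n + i, j))))))
      (\<psi> (mat n' n' (\<lambda>(i, j). M $$ (n + i, n + j))))"
  unfolding corner_map_def split_block_eq[OF assms] by simp

text \<open>Given injectivity, any preimage at hand may stand for \<open>inv_into\<close>, so no
  inverse has to be computed.\<close>

lemma q_transform_eqI:
  assumes "inj_on (\<lambda>A. A + complex_of_real t \<cdot>\<^sub>m f A) (carrier_mat m m)"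
    and "M \<in> carrier_mat m m" "M + complex_of_real t \<cdot>\<^sub>m f M = N"
  shows "q_transform m f t N = f M"
  using inv_into_f_f[OF assms(1,2)] assms(3) by (simp add: q_transform_def)

text \<open>Two distinct preimages of one matrix would differ by an eigenvector of \<open>f\<close>
  for the negative number \<open>- 1 / t\<close>; surjectivity then follows from finite dimension.
  This serves the competitor map, for which there is no formula.\<close>

lemma q_positive_bij:
  assumes q: "q_positive m f" and t: "0 \<le> t"
  defines "g \<equiv> \<lambda>A. A + complex_of_real t \<cdot>\<^sub>m f A"
  shows "inj_on g (carrier_mat m m)" "g ` carrier_mat m m = carrier_mat m m"
proof -
  have lin: "linear_on_mats m m f" using q by (simp add: q_positive_def)
  note f = lin[unfolded linear_on_mats_iff]
  have fc: "f A \<in> carrier_mat m m" if "A \<in> carrier_mat m m" for A using f that by blast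
  have fd: "f (A - B) = f A - f B" if "A \<in> carrier_mat m m" "B \<in> carrier_mat m m" for A B
  proof -
    have "A - B = A + (-1) \<cdot>\<^sub>m B" using that by (intro eq_matI) auto
    then have "f (A - B) = f A + (-1) \<cdot>\<^sub>m f B" using f that by simp
    also have "\<dots> = f A - f B" using fc that by (intro eq_matI) auto
    finally show ?thesis .
  qed
  show inj: "inj_on g (carrier_mat m m)"
  proof (rule inj_onI)
    fix A B assume AB: "A \<in> carrier_mat m m" "B \<in> carrier_mat m m" "g A = g B"
    show "A = B"
    proof (rule ccontr)
      assume ne: "A \<noteq> B"
      have fAB: "f A \<in> carrier_mat m m" "f B \<in> carrier_mat m m" using AB fc by auto
      have e: "A $$ (i, j) + of_real t * f A $$ (i, j) = B $$ (i, j) + of_real t * f B $$ (i, j)" if "i < m" "j < m" for i j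
      proof -
        have "g A $$ (i, j) = g B $$ (i, j)" using AB(3) by simp
        then show ?thesis using that fAB AB by (simp add: g_def)
      qed
      have t0: "t \<noteq> 0"
      proof
        assume "t = 0"
        then have "A = B" using AB e by (intro eq_matI) auto
        with ne show False by simp
      qed
      have "f (A - B) = complex_of_real (- 1 / t) \<cdot>\<^sub>m (A - B)"
      proof -
        have "f A $$ (i, j) - f B $$ (i, j) = of_real (- 1 / t) * (A $$ (i, j) - B $$ (i, j))" if "i < m" "j < m" for i j
          using e[OF that] t0 by (simp add: field_simps)
        then show ?thesis unfolding fd[OF AB(1,2)] using fAB AB by (intro eq_matI) auto
      qed
      moreover have "A - B \<noteq> 0\<^sub>m m m"
      proof
        assume z: "A - B = 0\<^sub>m m m"
        have "A $$ (i, j) = B $$ (i, j)" if "i < m" "j < m" for i j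
        proof -
          have "(A - B) $$ (i, j) = 0" using z that by simp
          then show ?thesis using that AB by simp
        qed
        then have "A = B" using AB by (intro eq_matI) auto
        with ne show False by simp
      qed
      moreover have "A - B \<in> carrier_mat m m" using AB(2) by (rule minus_carrier_mat)
      ultimately have "eigenvalue_of_map m f (complex_of_real (- 1 / t))"
        unfolding eigenvalue_of_map_def by blast
      moreover have "- 1 / t < 0" using t t0 by simp
      ultimately show False using q unfolding q_positive_def by blast
    qed
  qed
  have "linear_on_mats m m g"
    unfolding linear_on_mats_iff
  proof (intro conjI ballI allI)
    fix A :: "complex mat" assume "A \<in> carrier_mat m m"
    then show "g A \<in> carrier_mat m m" using fc by (simp add: g_def)
  next
    fix A B :: "complex mat" assume AB: "A \<in> carrier_mat m m" "B \<in> carrier_mat m m"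
    have "f (A + B) = f A + f B" using f AB by simp
    then show "g (A + B) = g A + g B"
      using AB fc[OF AB(1)] fc[OF AB(2)] by (intro eq_matI) (auto simp: g_def algebra_simps)
  next
    fix c and A :: "complex mat" assume A: "A \<in> carrier_mat m m"
    have "f (c \<cdot>\<^sub>m A) = c \<cdot>\<^sub>m f A" using f A by simp
    then show "g (c \<cdot>\<^sub>m A) = c \<cdot>\<^sub>m g A"
      using A fc[OF A] by (intro eq_matI) (auto simp: g_def algebra_simps)
  qed
  from linear_endo_inj_imp_surj[OF this fin_dim_mats] inj
  show "g ` carrier_mat m m = carrier_mat m m" by (simp add: matrix_vs_simps)
qed

text \<open>The off-diagonal blocks come from \<open>\<gamma>\<close> alone. The carrier hypotheses
  fix the place of the cut, which \<open>four_block_mat\<close> reads off the dimensions of its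
  diagonal blocks.\<close>

lemma corner_map_off_diagonal:
  assumes M: "M \<in> carrier_mat (n + n') (n + n')"
    and "\<And>A. A \<in> carrier_mat n n \<Longrightarrow> \<phi> A \<in> carrier_mat n n" "\<And>A. A \<in> carrier_mat n n \<Longrightarrow> \<phi>' A \<in> carrier_mat n n"
    and "\<And>A. A \<in> carrier_mat n' n' \<Longrightarrow> \<psi> A \<in> carrier_mat n' n'" "\<And>A. A \<in> carrier_mat n' n' \<Longrightarrow> \<psi>' A \<in> carrier_mat n' n'"
    and ij: "i < n + n'" "j < n + n'" "(i < n) \<noteq> (j < n)"
  shows "corner_map n \<phi> \<gamma> \<psi> M $$ (i, j) = corner_map n \<phi>' \<gamma> \<psi>' M $$ (i, j)"
proof -
  let ?A = "mat n n (\<lambda>(i, j). M $$ (i, j))" and ?D = "mat n' n' (\<lambda>(i, j). M $$ (n + i, n + j))"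
  have "\<phi> ?A \<in> carrier_mat n n" "\<phi>' ?A \<in> carrier_mat n n" "\<psi> ?D \<in> carrier_mat n' n'" "\<psi>' ?D \<in> carrier_mat n' n'"
    using assms by auto
  then show ?thesis unfolding corner_map_eq[OF M] using ij by auto
qed

section \<open>Contractions and traces\<close>

definition contraction_on :: "nat \<Rightarrow> nat \<Rightarrow> (nat \<Rightarrow> nat \<Rightarrow> complex) \<Rightarrow> bool" where
  "contraction_on p q A \<longleftrightarrow> (\<forall>v. (\<Sum>i<p. (cmod (\<Sum>j<q. A i j * v j))\<^sup>2) \<le> (\<Sum>j<q. (cmod (v j))\<^sup>2))"

lemma sum_norm_square_eq:
  "complex_of_real (\<Sum>i\<in>I. (cmod (f i))\<^sup>2) = (\<Sum>i\<in>I. cnj (f i) * f i)"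
  by (simp add: complex_norm_square mult.commute del: of_real_power)

text \<open>Let \<open>s\<close> be the squared norm of \<open>A\<^sup>* u\<close>. Then
  \<open>s = \<langle>u, A A\<^sup>* u\<rangle>\<close> is at most the mean of the squared norms of
  \<open>u\<close> and of \<open>A A\<^sup>* u\<close>, and the latter is at most \<open>s\<close>;
  absorbing \<open>s / 2\<close> gives the bound.\<close>

lemma contraction_on_adjoint:
  assumes A: "contraction_on p q A"
  shows "contraction_on q p (\<lambda>i j. cnj (A j i))"
  unfolding contraction_on_def
proof
  fix u
  define a where "a l = (\<Sum>j<p. cnj (A j l) * u j)" for l
  define s where "s = (\<Sum>l<q. (cmod (a l))\<^sup>2)"
  have "complex_of_real s = (\<Sum>l<q. \<Sum>j<p. cnj (cnj (A j l) * u j) * a l)"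
    unfolding s_def sum_norm_square_eq by (simp add: a_def sum_distrib_right)
  also have "\<dots> = (\<Sum>j<p. cnj (u j) * (\<Sum>l<q. A j l * a l))"
    by (subst sum.swap) (simp add: sum_distrib_left mult_ac)
  finally have "s = Re (\<Sum>j<p. cnj (u j) * (\<Sum>l<q. A j l * a l))"
    by (metis Re_complex_of_real)
  also have "\<dots> \<le> (\<Sum>j<p. cmod (u j) * cmod (\<Sum>l<q. A j l * a l))"
    by (rule order_trans[OF complex_Re_le_cmod]) (intro sum_norm_le, simp add: norm_mult)
  also have "\<dots> \<le> (\<Sum>j<p. ((cmod (u j))\<^sup>2 + (cmod (\<Sum>l<q. A j l * a l))\<^sup>2) / 2)"
  proof (intro sum_mono)
    fix j
    show "cmod (u j) * cmod (\<Sum>l<q. A j l * a l) \<le> ((cmod (u j))\<^sup>2 + (cmod (\<Sum>l<q. A j l * a l))\<^sup>2) / 2"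
      using sum_squares_bound[of "cmod (u j)" "cmod (\<Sum>l<q. A j l * a l)"] by simp
  qed
  also have "\<dots> = ((\<Sum>j<p. (cmod (u j))\<^sup>2) + (\<Sum>j<p. (cmod (\<Sum>l<q. A j l * a l))\<^sup>2)) / 2"
    by (simp add: sum.distrib sum_divide_distrib[symmetric])
  also have "\<dots> \<le> ((\<Sum>j<p. (cmod (u j))\<^sup>2) + s) / 2"
    using A unfolding contraction_on_def s_def by simp
  finally show "(\<Sum>i<q. (cmod (\<Sum>j<p. cnj (A j i) * u j))\<^sup>2) \<le> (\<Sum>j<p. (cmod (u j))\<^sup>2)"
    unfolding s_def a_def by simp
qed

lemma psd_on_one_minus_contraction:
  assumes A: "contraction_on p q A"
  shows "psd_on {..<q} (\<lambda>i j. (if i = j then 1 else 0) - (\<Sum>l<p. cnj (A l i) * A l j))"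
  unfolding psd_on_def
proof
  fix v :: "nat \<Rightarrow> complex"
  have "(\<Sum>i<q. \<Sum>j<q. cnj (v i) * ((if i = j then 1 else 0) - (\<Sum>l<p. cnj (A l i) * A l j)) * v j)
    = (\<Sum>i<q. \<Sum>j<q. (if i = j then cnj (v i) * v j else 0) - (\<Sum>l<p. (cnj (A l i) * cnj (v i)) * (A l j * v j)))"
    by (intro sum.cong refl) (simp add: algebra_simps sum_distrib_left)
  also have "\<dots> = (\<Sum>i<q. cnj (v i) * v i) - (\<Sum>i<q. \<Sum>j<q. \<Sum>l<p. (cnj (A l i) * cnj (v i)) * (A l j * v j))"
    by (simp add: sum_subtractf)
  also have "(\<Sum>i<q. \<Sum>j<q. \<Sum>l<p. (cnj (A l i) * cnj (v i)) * (A l j * v j))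
    = (\<Sum>i<q. \<Sum>l<p. \<Sum>j<q. (cnj (A l i) * cnj (v i)) * (A l j * v j))"
    by (intro sum.cong refl sum.swap)
  also have "\<dots> = (\<Sum>l<p. \<Sum>i<q. \<Sum>j<q. (cnj (A l i) * cnj (v i)) * (A l j * v j))"
    by (rule sum.swap)
  also have "\<dots> = (\<Sum>l<p. cnj (\<Sum>j<q. A l j * v j) * (\<Sum>j<q. A l j * v j))"
    by (simp add: sum_product)
  also have "(\<Sum>i<q. cnj (v i) * v i) - \<dots> = of_real ((\<Sum>i<q. (cmod (v i))\<^sup>2) - (\<Sum>l<p. (cmod (\<Sum>j<q. A l j * v j))\<^sup>2))"
    unfolding of_real_diff sum_norm_square_eq ..
  finally show "0 \<le> (\<Sum>i<q. \<Sum>j<q. cnj (v i) * ((if i = j then 1 else 0) - (\<Sum>l<p. cnj (A l i) * A l j)) * v j)"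
    using A[unfolded contraction_on_def, rule_format, of v] by (simp add: less_eq_complex_def)
qed

lemma euclidean_norm_vec_eq: "euclidean_norm_vec v = sqrt (\<Sum>i<dim_vec v. (cmod (v $ i))\<^sup>2)"
  by (simp add: euclidean_norm_vec_def L2_set_def)

text \<open>Rescaling to the unit ball. The supremum bounds its members only once the set of norms
  is known to be bounded above, which the crude entrywise estimate \<open>bdd\<close>
  provides.\<close>

lemma contraction_mat_imp:
  assumes E: "E \<in> carrier_mat p q" and c: "contraction_mat E"
  shows "contraction_on p q (\<lambda>i j. E $$ (i, j))"
  unfolding contraction_on_def
proof
  fix v :: "nat \<Rightarrow> complex"
  define B where "B = {v \<in> carrier_vec (dim_col E). euclidean_norm_vec v \<le> 1}"
  have dims: "dim_row E = p" "dim_col E = q" using E by auto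
  have norm_Ev: "euclidean_norm_vec (E *\<^sub>v x) = sqrt (\<Sum>i<p. (cmod (\<Sum>j<q. E $$ (i, j) * x $ j))\<^sup>2)"
    if "dim_vec x = q" for x
    using that by (simp add: euclidean_norm_vec_eq dims scalar_prod_def atLeast0LessThan cong: sum.cong_simp)
  have bdd: "bdd_above ((\<lambda>v. euclidean_norm_vec (E *\<^sub>v v)) ` B)"
  proof (rule bdd_aboveI2)
    fix x assume x: "x \<in> B"
    then have dx: "dim_vec x = q" and nx: "(\<Sum>j<q. (cmod (x $ j))\<^sup>2) \<le> 1"
      by (auto simp: B_def euclidean_norm_vec_eq dims)
    have xj: "cmod (x $ j) \<le> 1" if "j < q" for j
    proof -
      have "(cmod (x $ j))\<^sup>2 \<le> (\<Sum>j<q. (cmod (x $ j))\<^sup>2)" using that by (intro member_le_sum) auto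
      then have "(cmod (x $ j))\<^sup>2 \<le> 1" using nx by linarith
      then show ?thesis by (simp add: power_le_one_iff)
    qed
    have "cmod (\<Sum>j<q. E $$ (i, j) * x $ j) \<le> (\<Sum>j<q. cmod (E $$ (i, j)))" for i
      by (intro sum_norm_le) (use xj in \<open>auto simp: norm_mult intro: mult_left_le\<close>)
    then show "euclidean_norm_vec (E *\<^sub>v x) \<le> sqrt (\<Sum>i<p. (\<Sum>j<q. cmod (E $$ (i, j)))\<^sup>2)"
      unfolding norm_Ev[OF dx] by (intro real_sqrt_le_mono sum_mono power_mono) auto
  qed
  have le1: "(\<Sum>i<p. (cmod (\<Sum>j<q. E $$ (i, j) * x j))\<^sup>2) \<le> 1" if "(\<Sum>j<q. (cmod (x j))\<^sup>2) \<le> 1" for x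
  proof -
    have "vec q x \<in> B" using that by (simp add: B_def euclidean_norm_vec_eq dims)
    then have "euclidean_norm_vec (E *\<^sub>v vec q x) \<le> (SUP v\<in>B. euclidean_norm_vec (E *\<^sub>v v))"
      by (rule cSUP_upper[OF _ bdd])
    also have "\<dots> \<le> 1" using c by (simp add: contraction_mat_def operator_norm_mat_def B_def)
    finally show ?thesis by (simp add: norm_Ev)
  qed
  define r where "r = sqrt (\<Sum>j<q. (cmod (v j))\<^sup>2)"
  have r2: "r\<^sup>2 = (\<Sum>j<q. (cmod (v j))\<^sup>2)" by (simp add: r_def sum_nonneg)
  show "(\<Sum>i<p. (cmod (\<Sum>j<q. E $$ (i, j) * v j))\<^sup>2) \<le> (\<Sum>j<q. (cmod (v j))\<^sup>2)"
  proof (cases "r = 0")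
    case True
    then have "\<forall>j\<in>{..<q}. (cmod (v j))\<^sup>2 = 0" using r2 by (subst sum_nonneg_eq_0_iff[symmetric]) auto
    then show ?thesis by simp
  next
    case False
    have sc: "(\<Sum>i\<in>I. (cmod (f i / of_real r))\<^sup>2) = (\<Sum>i\<in>I. (cmod (f i))\<^sup>2) / r\<^sup>2" for I and f :: "nat \<Rightarrow> complex"
      by (simp add: norm_divide power_divide sum_divide_distrib)
    have "(\<Sum>j<q. (cmod (v j / of_real r))\<^sup>2) \<le> 1" unfolding sc r2[symmetric] using False by simp
    from le1[OF this] have "(\<Sum>i<p. (cmod ((\<Sum>j<q. E $$ (i, j) * v j) / of_real r))\<^sup>2) \<le> 1"
      by (simp add: sum_divide_distrib)
    then show ?thesis unfolding sc r2[symmetric] using False by (simp add: divide_le_eq)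
  qed
qed

text \<open>Serves to get \<open>n = n'\<close>: once \<open>V V\<^sup>*\<close> and
  \<open>V\<^sup>* V\<close> are identities, their equal traces are \<open>n\<close> and
  \<open>n'\<close>.\<close>

lemma mat_trace_mult_commute:
  assumes "A \<in> carrier_mat p q" "B \<in> carrier_mat q p"
  shows "mat_trace (A * B) = mat_trace (B * A)"
proof -
  have d: "dim_row A = p" "dim_col A = q" "dim_row B = q" "dim_col B = p" using assms by auto
  have "mat_trace (A * B) = (\<Sum>i<p. \<Sum>j<q. A $$ (i, j) * B $$ (j, i))"
    by (simp add: mat_trace_def d scalar_prod_def atLeast0LessThan cong: sum.cong_simp)
  also have "\<dots> = (\<Sum>j<q. \<Sum>i<p. B $$ (j, i) * A $$ (i, j))"
    by (subst sum.swap) (simp add: mult.commute)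
  also have "\<dots> = mat_trace (B * A)"
    by (simp add: mat_trace_def d scalar_prod_def atLeast0LessThan cong: sum.cong_simp)
  finally show ?thesis .
qed

lemma mat_trace_one: "mat_trace (1\<^sub>m p) = of_nat p"
  by (simp add: mat_trace_def)

lemma sum_delta_mult:
  fixes f :: "nat \<Rightarrow> complex"
  assumes "d < q"
  shows "(\<Sum>l<q. f l * (if d = l then 1 else 0)) = f d" "(\<Sum>l<q. (if d = l then 1 else 0) * f l) = f d"
    "(\<Sum>l<q. f l * cnj (if d = l then 1 else 0)) = f d"
proof -
  have "(\<Sum>l<q. f l * (if d = l then 1 else 0)) = (\<Sum>l<q. if d = l then f l else 0)"
    "(\<Sum>l<q. (if d = l then 1 else 0) * f l) = (\<Sum>l<q. if d = l then f l else 0)"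
    "(\<Sum>l<q. f l * cnj (if d = l then 1 else 0)) = (\<Sum>l<q. if d = l then f l else 0)"
    by (intro sum.cong refl; simp)+
  then show "(\<Sum>l<q. f l * (if d = l then 1 else 0)) = f d" "(\<Sum>l<q. (if d = l then 1 else 0) * f l) = f d"
    "(\<Sum>l<q. f l * cnj (if d = l then 1 else 0)) = f d"
    using assms by simp_all
qed

section \<open>Corner maps given by weight matrices\<close>

text \<open>The hypotheses in entries: \<open>X_orthonormal\<close> is
  \<open>X\<^sup>* X = I\<close>, and \<open>X_commute\<close> is
  \<open>X \<Omega> X\<^sup>* = \<Omega>\<close>, which combines commutation with unitarity.\<close>

locale corner_data =
  fixes k n n' :: nat and \<mu> :: "nat \<Rightarrow> real" and X E :: "complex mat" and lam :: complex
    and \<gamma> :: "complex mat \<Rightarrow> complex mat"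
  assumes mu_pos: "\<And>i. i < k \<Longrightarrow> 0 < \<mu> i"
    and mu_sum: "(\<Sum>i<k. \<mu> i) = 1"
    and k_le: "k \<le> n" "k \<le> n'"
    and X_carrier: "X \<in> carrier_mat k k"
    and X_orthonormal: "\<And>i j. i < k \<Longrightarrow> j < k \<Longrightarrow> (\<Sum>a<k. cnj (X $$ (a, i)) * X $$ (a, j)) = (if i = j then 1 else 0)"
    and X_commute: "\<And>i j. i < k \<Longrightarrow> j < k \<Longrightarrow> (\<Sum>a<k. \<mu> a * X $$ (i, a) * cnj (X $$ (j, a))) = (if i = j then complex_of_real (\<mu> i) else 0)"
    and E_carrier: "E \<in> carrier_mat (n - k) (n' - k)"
    and E_contraction: "contraction_on (n - k) (n' - k) (\<lambda>i j. E $$ (i, j))"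
    and lam_le: "(cmod lam)\<^sup>2 \<le> Re lam"
    and gamma_eq: "\<And>B. B \<in> carrier_mat n n' \<Longrightarrow> \<gamma> B =
      (lam * (\<Sum>l<k. \<mu> l * (\<Sum>a<k. cnj (X $$ (a, l)) * B $$ (a, l)))) \<cdot>\<^sub>m
        four_block_mat X (0\<^sub>m k (n' - k)) (0\<^sub>m (n - k) k) E"
begin

definition V where "V = four_block_mat X (0\<^sub>m k (n' - k)) (0\<^sub>m (n - k) k) E"

text \<open>
  On a matrix with blocks \<open>A, B, C, D\<close> the four values of \<open>rho\<close> are the numbers by which
  \<open>\<phi>\<close>, \<open>\<gamma>\<close>, \<open>\<gamma>\<^sup>*\<close>, \<open>\<psi>\<close> scale \<open>I\<close>, \<open>\<lambda> V\<close>, \<open>\<lambda>\<^sup>* V\<^sup>*\<close>, \<open>I\<close>; the truth values select the first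
  or second row and column of blocks. The vectors \<open>\<kappa>\<close> exhibit them in Kraus form, which uses that
  \<open>X\<close> commutes with \<open>\<Omega>\<close>.
\<close>

definition \<kappa> :: "nat \<Rightarrow> bool \<Rightarrow> nat \<Rightarrow> complex" where
  "\<kappa> l p a = (if p then if a < k then cnj (X $$ (a, l)) else 0 else if a = n + l then 1 else 0)"

definition rho :: "complex mat \<Rightarrow> bool \<Rightarrow> bool \<Rightarrow> complex" where
  "rho M p q = (\<Sum>l<k. of_real (\<mu> l) * (\<Sum>a<n+n'. \<Sum>b<n+n'. \<kappa> l p a * M $$ (a, b) * cnj (\<kappa> l q b)))"

definition H :: "(nat \<Rightarrow> nat \<Rightarrow> complex) \<Rightarrow> complex mat \<Rightarrow> complex mat" where
  "H W M = mat (n + n') (n + n') (\<lambda>(i, j). W i j * rho M (i < n) (j < n))"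

text \<open>Block rows \<open>(p S, z V)\<close> and \<open>(z\<^sup>* V\<^sup>*, p T)\<close>. A
  map and its transforms share \<open>S\<close>, \<open>T\<close> and \<open>V\<close> and differ
  only in the scalars \<open>p\<close> and \<open>z\<close>.\<close>

definition wt :: "complex \<Rightarrow> complex \<Rightarrow> complex mat \<Rightarrow> complex mat \<Rightarrow> nat \<Rightarrow> nat \<Rightarrow> complex" where
  "wt p z S T i j =
    (if i < n then if j < n then p * S $$ (i, j) else z * V $$ (i, j - n)
     else if j < n then cnj z * cnj (V $$ (j, i - n)) else p * T $$ (i - n, j - n))"

text \<open>The eigenvalue attached to a block: if \<open>S\<close> and \<open>T\<close> have ones
  at the first \<open>k\<close> diagonal places, \<open>H (wt p z S T)\<close> multiplies the value
  of \<open>rho\<close> on the block \<open>x\<close>, \<open>y\<close> by it.\<close>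

definition \<eta> :: "complex \<Rightarrow> complex \<Rightarrow> bool \<Rightarrow> bool \<Rightarrow> complex" where
  "\<eta> p z x y = (if x = y then p else if x then z else cnj z)"

lemma V_carrier: "V \<in> carrier_mat n n'"
  using k_le X_carrier E_carrier four_block_carrier_mat[OF X_carrier E_carrier]
  by (simp add: V_def)

lemma V_index:
  assumes "i < n" "j < n'"
  shows "V $$ (i, j) = (if i < k then if j < k then X $$ (i, j) else 0
    else if j < k then 0 else E $$ (i - k, j - k))"
  using assms k_le X_carrier E_carrier unfolding V_def by auto

lemma H_carrier [simp]: "H W M \<in> carrier_mat (n + n') (n + n')"
  by (simp add: H_def)

lemma H_index: "i < n + n' \<Longrightarrow> j < n + n' \<Longrightarrow> H W M $$ (i, j) = W i j * rho M (i < n) (j < n)"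
  by (simp add: H_def)

text \<open>\<open>\<kappa> l p\<close> is supported on one half of the indices, which uses
  \<open>k \<le> n\<close>; so \<open>rho M p q\<close> sees only one block of
  \<open>M\<close>.\<close>

lemma rho_cong:
  assumes "\<And>i j. i < n + n' \<Longrightarrow> j < n + n' \<Longrightarrow> (i < n) = p \<Longrightarrow> (j < n) = q \<Longrightarrow> M $$ (i, j) = N $$ (i, j)"
  shows "rho M p q = rho N p q"
proof -
  have z: "\<kappa> l x c = 0" if "l < k" "(c < n) \<noteq> x" for l c x
    using that k_le by (auto simp: \<kappa>_def)
  have "\<kappa> l p a * M $$ (a, b) * cnj (\<kappa> l q b) = \<kappa> l p a * N $$ (a, b) * cnj (\<kappa> l q b)"
    if "l < k" "a < n + n'" "b < n + n'" for l a b
    using assms[of a b] z[of l a p] z[of l b q] that by (cases "(a < n) = p \<and> (b < n) = q") auto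
  then have "(\<Sum>a<n+n'. \<Sum>b<n+n'. \<kappa> l p a * M $$ (a, b) * cnj (\<kappa> l q b))
    = (\<Sum>a<n+n'. \<Sum>b<n+n'. \<kappa> l p a * N $$ (a, b) * cnj (\<kappa> l q b))" if "l < k" for l
    using that by (intro sum.cong refl) (simp only: lessThan_iff)
  then show ?thesis unfolding rho_def by (intro sum.cong refl) (simp only: lessThan_iff)
qed

lemma rho_smult:
  assumes "M \<in> carrier_mat (n + n') (n + n')"
  shows "rho (c \<cdot>\<^sub>m M) p q = c * rho M p q"
  using assms unfolding rho_def by (simp add: sum_distrib_left mult_ac)

lemma rho_add_scale:
  assumes "M \<in> carrier_mat (n+n') (n+n')" "N \<in> carrier_mat (n+n') (n+n')"
  shows "rho (M + c \<cdot>\<^sub>m N) p q = rho M p q + c * rho N p q"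
  using assms unfolding rho_def by (simp add: algebra_simps sum.distrib sum_distrib_left)

lemma sum_kappa:
  assumes "l < k"
  shows "(\<Sum>a<n+n'. \<kappa> l True a * F a) = (\<Sum>a<k. cnj (X $$ (a, l)) * F a)"
    "(\<Sum>a<n+n'. \<kappa> l False a * F a) = F (n + l)"
    "(\<Sum>a<n+n'. F a * cnj (\<kappa> l True a)) = (\<Sum>a<k. F a * X $$ (a, l))"
    "(\<Sum>a<n+n'. F a * cnj (\<kappa> l False a)) = F (n + l)"
proof -
  have "(\<Sum>a<n+n'. \<kappa> l True a * F a) = (\<Sum>a<k. \<kappa> l True a * F a)" for F
    using k_le by (intro sum.mono_neutral_right) (auto simp: \<kappa>_def)
  from this[of F] show "(\<Sum>a<n+n'. \<kappa> l True a * F a) = (\<Sum>a<k. cnj (X $$ (a, l)) * F a)"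
    by (simp add: \<kappa>_def)
  have "(\<Sum>a<n+n'. F a * cnj (\<kappa> l True a)) = (\<Sum>a<k. F a * cnj (\<kappa> l True a))"
    using k_le by (intro sum.mono_neutral_right) (auto simp: \<kappa>_def)
  then show "(\<Sum>a<n+n'. F a * cnj (\<kappa> l True a)) = (\<Sum>a<k. F a * X $$ (a, l))"
    by (simp add: \<kappa>_def)
  have "(\<Sum>a<n+n'. \<kappa> l False a * F a) = (\<Sum>a<n+n'. if a = n + l then F a else 0)"
    "(\<Sum>a<n+n'. F a * cnj (\<kappa> l False a)) = (\<Sum>a<n+n'. if a = n + l then F a else 0)"
    by (intro sum.cong refl; simp add: \<kappa>_def)+
  then show "(\<Sum>a<n+n'. \<kappa> l False a * F a) = F (n + l)"
    "(\<Sum>a<n+n'. F a * cnj (\<kappa> l False a)) = F (n + l)"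
    using assms k_le by auto
qed

text \<open>On the upper left block the vectors \<open>\<kappa>\<close> express the functional in
  the basis of the columns of \<open>X\<close>; because of
  \<open>X \<Omega> X\<^sup>* = \<Omega>\<close> it is the same weighted diagonal sum as in the
  standard basis. The second half of the indices uses the standard basis outright.\<close>

lemma rho_blocks:
  "rho M True True = (\<Sum>i<k. of_real (\<mu> i) * M $$ (i, i))"
  "rho M False False = (\<Sum>i<k. of_real (\<mu> i) * M $$ (n + i, n + i))"
  "rho M True False = (\<Sum>l<k. of_real (\<mu> l) * (\<Sum>a<k. cnj (X $$ (a, l)) * M $$ (a, n + l)))"
  "rho M False True = (\<Sum>l<k. of_real (\<mu> l) * (\<Sum>a<k. M $$ (n + l, a) * X $$ (a, l)))"
proof -
  have *: "rho M p q = (\<Sum>l<k. of_real (\<mu> l) * (\<Sum>a<n+n'. \<kappa> l p a * (\<Sum>b<n+n'. M $$ (a, b) * cnj (\<kappa> l q b))))" for p q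
    unfolding rho_def by (simp add: sum_distrib_left mult_ac)
  have "rho M True True = (\<Sum>l<k. of_real (\<mu> l) * (\<Sum>a<k. cnj (X $$ (a, l)) * (\<Sum>b<k. M $$ (a, b) * X $$ (b, l))))"
    unfolding * by (intro sum.cong refl) (simp add: sum_kappa)
  also have "\<dots> = (\<Sum>l<k. \<Sum>a<k. \<Sum>b<k. M $$ (a, b) * (\<mu> l * X $$ (b, l) * cnj (X $$ (a, l))))"
    by (simp add: sum_distrib_left mult_ac)
  also have "\<dots> = (\<Sum>a<k. \<Sum>l<k. \<Sum>b<k. M $$ (a, b) * (\<mu> l * X $$ (b, l) * cnj (X $$ (a, l))))"
    by (rule sum.swap)
  also have "\<dots> = (\<Sum>a<k. \<Sum>b<k. \<Sum>l<k. M $$ (a, b) * (\<mu> l * X $$ (b, l) * cnj (X $$ (a, l))))"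
    by (intro sum.cong refl sum.swap)
  also have "\<dots> = (\<Sum>a<k. \<Sum>b<k. M $$ (a, b) * (if b = a then of_real (\<mu> b) else 0))"
    by (intro sum.cong refl) (simp only: sum_distrib_left[symmetric] X_commute lessThan_iff)
  also have "\<dots> = (\<Sum>a<k. \<mu> a * M $$ (a, a))"
    by (intro sum.cong refl) (simp add: if_distrib[of "\<lambda>x. _ * x"] mult.commute cong: if_cong)
  finally show "rho M True True = (\<Sum>i<k. of_real (\<mu> i) * M $$ (i, i))" .
  show "rho M False False = (\<Sum>i<k. of_real (\<mu> i) * M $$ (n + i, n + i))"
    "rho M True False = (\<Sum>l<k. of_real (\<mu> l) * (\<Sum>a<k. cnj (X $$ (a, l)) * M $$ (a, n + l)))"
    "rho M False True = (\<Sum>l<k. of_real (\<mu> l) * (\<Sum>a<k. M $$ (n + l, a) * X $$ (a, l)))"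
    unfolding * by (auto simp: sum_kappa intro!: sum.cong)
qed

lemma mu_sum_complex: "(\<Sum>l<k. complex_of_real (\<mu> l)) = 1"
  using mu_sum by (metis of_real_1 of_real_sum)

text \<open>\<open>rho\<close> reads only the first \<open>k\<close> diagonal entries of
  \<open>S\<close> and \<open>T\<close> and the part \<open>X\<close> of \<open>V\<close>, whose
  columns are unit vectors. The freedom left in \<open>S\<close> and \<open>T\<close> is what admits
  \<open>V V\<^sup>*\<close> and \<open>V\<^sup>* V\<close> as blocks of a competitor.\<close>

lemma rho_wt:
  assumes S: "\<And>i. i < k \<Longrightarrow> S $$ (i, i) = 1" and T: "\<And>i. i < k \<Longrightarrow> T $$ (i, i) = 1"
  shows "rho (mat (n + n') (n + n') (\<lambda>(i, j). wt p z S T i j)) x y = \<eta> p z x y"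
proof -
  have lt: "i < k \<Longrightarrow> i < n" "i < k \<Longrightarrow> i < n'"  "i < k \<Longrightarrow> i < n + n'" for i using k_le by auto
  have X1: "(\<Sum>a<k. cnj (X $$ (a, l)) * X $$ (a, l)) = 1" if "l < k" for l
    using X_orthonormal[OF that that] by simp
  have TF: "(\<Sum>a<k. cnj (X $$ (a, l)) * (z * V $$ (a, l))) = z" if "l < k" for l
  proof -
    have "(\<Sum>a<k. cnj (X $$ (a, l)) * (z * V $$ (a, l))) = z * (\<Sum>a<k. cnj (X $$ (a, l)) * X $$ (a, l))"
      using lt that by (simp add: V_index sum_distrib_left mult_ac)
    then show ?thesis using X1 that by simp
  qed
  have FT: "(\<Sum>a<k. cnj z * cnj (V $$ (a, l)) * X $$ (a, l)) = cnj z" if "l < k" for l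
  proof -
    have "(\<Sum>a<k. cnj z * cnj (V $$ (a, l)) * X $$ (a, l)) = cnj z * (\<Sum>a<k. cnj (X $$ (a, l)) * X $$ (a, l))"
      using lt that by (simp add: V_index sum_distrib_left mult_ac)
    then show ?thesis using X1 that by simp
  qed
  show ?thesis
    by (cases x; cases y)
      (auto simp: rho_blocks lt wt_def S T TF FT \<eta>_def mu_sum_complex sum_distrib_right[symmetric])
qed

text \<open>Each block of \<open>H W M\<close> is a scalar multiple of the block of
  \<open>W\<close>, so \<open>rho\<close> after \<open>H W\<close> is \<open>rho\<close> times a
  scalar. This lets \<open>I + t \<Theta>\<close> be inverted by hand.\<close>

lemma rho_H_wt:
  assumes S: "\<And>i. i < k \<Longrightarrow> S $$ (i, i) = 1" and T: "\<And>i. i < k \<Longrightarrow> T $$ (i, i) = 1"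
  shows "rho (H (wt p z S T) M) x y = \<eta> p z x y * rho M x y"
proof -
  have "rho (H (wt p z S T) M) x y = rho (rho M x y \<cdot>\<^sub>m mat (n + n') (n + n') (\<lambda>(i, j). wt p z S T i j)) x y"
    by (intro rho_cong) (auto simp: H_index)
  also have "\<dots> = rho M x y * rho (mat (n + n') (n + n') (\<lambda>(i, j). wt p z S T i j)) x y"
    by (rule rho_smult) simp
  also have "rho (mat (n + n') (n + n') (\<lambda>(i, j). wt p z S T i j)) x y = \<eta> p z x y"
    by (rule rho_wt[OF S T])
  finally show ?thesis by simp
qed

section \<open>Complete positivity and transforms of weighted block maps\<close>

lemma completely_positive_H:
  assumes "\<And>A. A \<in> carrier_mat (n + n') (n + n') \<Longrightarrow> f A = H W A" and "psd_on {..<n + n'} W"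
  shows "completely_positive (n + n') f"
  using mu_pos by (intro completely_positiveI[where W = W and L = "{..<k}" and c = \<mu> and \<kappa> = "\<lambda>l i. \<kappa> l (i < n)"])
    (auto simp: assms H_index rho_def less_imp_le)

lemma one_plus_nonzero: "Re x \<ge> 0 \<Longrightarrow> t \<ge> 0 \<Longrightarrow> 1 + complex_of_real t * x \<noteq> 0"
proof
  assume "Re x \<ge> 0" "t \<ge> 0" "1 + complex_of_real t * x = 0"
  then have "1 + t * Re x = 0" by (simp add: complex_eq_iff)
  with \<open>Re x \<ge> 0\<close> \<open>t \<ge> 0\<close> show False by (simp add: add_nonneg_eq_0_iff)
qed

lemma Re_lam: "Re lam \<ge> 0"
  using lam_le by (meson order_trans zero_le_power2)

text \<open>Since \<open>I + t f\<close> multiplies \<open>rho\<close> by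
  \<open>1 + t \<eta>\<close> on each block, the preimage of \<open>N\<close> is
  \<open>N - t H W' N\<close> with \<open>W' = W / (1 + t \<eta>)\<close>: a rank-one inversion
  formula on every block.\<close>

lemma q_transform_H:
  assumes f: "\<And>A. A \<in> carrier_mat (n + n') (n + n') \<Longrightarrow> f A = H (wt (of_real c) lam S T) A"
    and c: "0 \<le> c" and S: "\<And>i. i < k \<Longrightarrow> S $$ (i, i) = 1" and T: "\<And>i. i < k \<Longrightarrow> T $$ (i, i) = 1"
    and t: "0 \<le> t" and N: "N \<in> carrier_mat (n + n') (n + n')"
  shows "q_transform (n + n') f t N = H (wt (of_real (c / (1 + t * c))) (lam / (1 + t * lam)) S T) N"
proof -
  define W where "W = wt (of_real c) lam S T"
  define W' where "W' = wt (of_real (c / (1 + t * c))) (lam / (1 + t * lam)) S T"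
  define e where "e = \<eta> (of_real c) lam"
  have Re_e: "Re (e x y) \<ge> 0" for x y using Re_lam c by (auto simp: e_def \<eta>_def)
  have e0: "1 + of_real t * e x y \<noteq> 0" for x y using one_plus_nonzero[OF Re_e t] .
  have W': "W' i j = W i j / (1 + of_real t * e (i < n) (j < n))" for i j
    by (auto simp: W'_def W_def wt_def e_def \<eta>_def)
  have rho_W: "rho (H W M) x y = e x y * rho M x y" for M x y
    unfolding W_def e_def by (rule rho_H_wt[OF S T])
  have rho_tot: "rho (M + of_real t \<cdot>\<^sub>m H W M) x y = (1 + of_real t * e x y) * rho M x y"
    if "M \<in> carrier_mat (n + n') (n + n')" for M x y
    using that by (simp add: rho_add_scale rho_W algebra_simps)
  define M where "M = N - of_real t \<cdot>\<^sub>m H W' N"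
  have M: "M \<in> carrier_mat (n + n') (n + n')" unfolding M_def by (rule minus_carrier_mat) simp
  show ?thesis
  proof (subst q_transform_eqI[of t f _ M])
    show "inj_on (\<lambda>A. A + of_real t \<cdot>\<^sub>m f A) (carrier_mat (n + n') (n + n'))"
    proof (rule inj_onI)
      fix A B assume AB: "A \<in> carrier_mat (n + n') (n + n')" "B \<in> carrier_mat (n + n') (n + n')"
        "A + of_real t \<cdot>\<^sub>m f A = B + of_real t \<cdot>\<^sub>m f B"
      then have eq: "A + of_real t \<cdot>\<^sub>m H W A = B + of_real t \<cdot>\<^sub>m H W B" by (simp add: f W_def)
      then have "rho A x y = rho B x y" for x y
        using rho_tot[OF AB(1), of x y] rho_tot[OF AB(2), of x y] e0[of x y] by simp
      then have HAB: "H W A = H W B" by (simp add: H_def)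
      show "A = B"
      proof (rule eq_matI)
        fix i j assume ij: "i < dim_row B" "j < dim_col B"
        have "(A + of_real t \<cdot>\<^sub>m H W B) $$ (i, j) = (B + of_real t \<cdot>\<^sub>m H W B) $$ (i, j)" using eq HAB by simp
        then show "A $$ (i, j) = B $$ (i, j)" using AB ij carrier_matD[OF H_carrier[of W B]] by simp
      qed (use AB in auto)
    qed
    have rho_M: "rho M x y = rho N x y / (1 + of_real t * e x y)" for x y
    proof -
      have "N = M + of_real t \<cdot>\<^sub>m H W' N"
        using N carrier_matD[OF H_carrier[of W' N]] by (intro eq_matI) (auto simp: M_def)
      then have "rho N x y = rho (M + of_real t \<cdot>\<^sub>m H W' N) x y" by (rule arg_cong)
      also have "\<dots> = rho M x y + of_real t * rho (H W' N) x y"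
        by (rule rho_add_scale[OF M H_carrier])
      also have "rho (H W' N) x y = rho (H W N) x y / (1 + of_real t * e x y)"
      proof -
        have "rho (H W' N) x y = rho ((1 / (1 + of_real t * e x y)) \<cdot>\<^sub>m H W N) x y"
          using carrier_matD[OF H_carrier[of W N]] by (intro rho_cong) (auto simp: H_index W')
        then show ?thesis by (simp add: rho_smult)
      qed
      also have "rho (H W N) x y = e x y * rho N x y" by (rule rho_W)
      finally have "rho M x y + of_real t * (e x y * rho N x y / (1 + of_real t * e x y)) = rho N x y"
        by (rule sym)
      then have "rho M x y = rho N x y - of_real t * (e x y * rho N x y / (1 + of_real t * e x y))"
        unfolding eq_diff_eq .
      also have "\<dots> = rho N x y / (1 + of_real t * e x y)" using e0[of x y] by (simp add: field_simps)
      finally show ?thesis .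
    qed
    have HM: "H W M = H W' N"
      by (rule eq_matI) (auto simp: H_def rho_M W')
    show "M + of_real t \<cdot>\<^sub>m f M = N"
      using N carrier_matD[OF H_carrier[of W' N]] unfolding f[OF M] W_def[symmetric] HM
      by (intro eq_matI) (auto simp: M_def)
    show "f M = H (wt (of_real (c / (1 + t * c))) (lam / (1 + t * lam)) S T) N"
      unfolding f[OF M] W_def[symmetric] HM W'_def ..
  qed (use M in auto)
qed

lemma corner_map_eq_H:
  assumes S: "S \<in> carrier_mat n n" and T: "T \<in> carrier_mat n' n'"
    and phi: "\<And>A. A \<in> carrier_mat n n \<Longrightarrow> \<phi> A = (c * (\<Sum>i<k. complex_of_real (\<mu> i) * A $$ (i, i))) \<cdot>\<^sub>m S"
    and psi: "\<And>A. A \<in> carrier_mat n' n' \<Longrightarrow> \<psi> A = (c * (\<Sum>i<k. complex_of_real (\<mu> i) * A $$ (i, i))) \<cdot>\<^sub>m T"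
    and M: "M \<in> carrier_mat (n + n') (n + n')"
  shows "corner_map n \<phi> \<gamma> \<psi> M = H (wt c lam S T) M"
proof (rule eq_matI)
  have lt: "i < k \<Longrightarrow> i < n" "i < k \<Longrightarrow> i < n'"  "i < k \<Longrightarrow> i < n + n'" for i using k_le by auto
  have A: "\<phi> (mat n n (\<lambda>(i, j). M $$ (i, j))) = (c * rho M True True) \<cdot>\<^sub>m S"
    by (simp add: phi rho_blocks lt)
  have D: "\<psi> (mat n' n' (\<lambda>(i, j). M $$ (n + i, n + j))) = (c * rho M False False) \<cdot>\<^sub>m T"
    by (simp add: psi rho_blocks lt)
  have B: "\<gamma> (mat n n' (\<lambda>(i, j). M $$ (i, n + j))) = (lam * rho M True False) \<cdot>\<^sub>m V"
    by (simp add: gamma_eq rho_blocks lt V_def)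
  have C: "\<gamma> (mat_adjoint (mat n' n (\<lambda>(i, j). M $$ (n + i, j)))) = (lam * cnj (rho M False True)) \<cdot>\<^sub>m V"
    by (subst gamma_eq) (auto simp: rho_blocks lt V_def mult_ac)
  fix i j assume "i < dim_row (H (wt c lam S T) M)" "j < dim_col (H (wt c lam S T) M)"
  then have ij: "i < n + n'" "j < n + n'" by (auto simp: H_def)
  show "corner_map n \<phi> \<gamma> \<psi> M $$ (i, j) = H (wt c lam S T) M $$ (i, j)"
    unfolding corner_map_eq[OF M] A B C D using ij S T V_carrier
    by (auto simp: H_index wt_def)
next
  show "dim_row (corner_map n \<phi> \<gamma> \<psi> M) = dim_row (H (wt c lam S T) M)"
    "dim_col (corner_map n \<phi> \<gamma> \<psi> M) = dim_col (H (wt c lam S T) M)"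
    using S T unfolding corner_map_eq[OF M] by (simp_all add: phi psi H_def)
qed

section \<open>Positivity of the weight matrices built from \<open>V\<close>\<close>

lemma X_isometry: "(\<Sum>i<k. (cmod (\<Sum>j<k. X $$ (i, j) * v j))\<^sup>2) = (\<Sum>j<k. (cmod (v j))\<^sup>2)"
proof -
  have "complex_of_real (\<Sum>i<k. (cmod (\<Sum>j<k. X $$ (i, j) * v j))\<^sup>2)
    = (\<Sum>i<k. \<Sum>j<k. \<Sum>l<k. cnj (v j) * v l * (cnj (X $$ (i, j)) * X $$ (i, l)))"
    by (simp only: sum_norm_square_eq cnj_sum complex_cnj_mult sum_product) (simp add: mult_ac)
  also have "\<dots> = (\<Sum>j<k. \<Sum>i<k. \<Sum>l<k. cnj (v j) * v l * (cnj (X $$ (i, j)) * X $$ (i, l)))"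
    by (rule sum.swap)
  also have "\<dots> = (\<Sum>j<k. \<Sum>l<k. \<Sum>i<k. cnj (v j) * v l * (cnj (X $$ (i, j)) * X $$ (i, l)))"
    by (intro sum.cong refl sum.swap)
  also have "\<dots> = (\<Sum>j<k. \<Sum>l<k. if j = l then cnj (v j) * v l else 0)"
    by (intro sum.cong refl) (simp add: sum_distrib_left[symmetric] X_orthonormal)
  also have "\<dots> = complex_of_real (\<Sum>j<k. (cmod (v j))\<^sup>2)"
    unfolding sum_norm_square_eq by simp
  finally show ?thesis by (simp only: of_real_eq_iff)
qed

lemma V_contraction: "contraction_on n n' (\<lambda>i j. V $$ (i, j))"
  unfolding contraction_on_def
proof
  fix v
  have split: "(\<Sum>i<q. F i) = (\<Sum>i<k. F i) + (\<Sum>i<q - k. F (k + i))" if "k \<le> q" for q and F :: "nat \<Rightarrow> 'b :: comm_monoid_add"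
    using sum_lessThan_add[of F k "q - k"] that by simp
  have "(\<Sum>i<n. (cmod (\<Sum>j<n'. V $$ (i, j) * v j))\<^sup>2)
    = (\<Sum>i<k. (cmod (\<Sum>j<k. X $$ (i, j) * v j))\<^sup>2) + (\<Sum>i<n - k. (cmod (\<Sum>j<n' - k. E $$ (i, j) * v (k + j)))\<^sup>2)"
    unfolding split[OF k_le(1)] split[OF k_le(2)] using k_le by (simp add: V_index)
  also have "\<dots> \<le> (\<Sum>j<k. (cmod (v j))\<^sup>2) + (\<Sum>j<n' - k. (cmod (v (k + j)))\<^sup>2)"
    using E_contraction[unfolded contraction_on_def, rule_format, of "\<lambda>j. v (k + j)"] X_isometry by simp
  finally show "(\<Sum>i<n. (cmod (\<Sum>j<n'. V $$ (i, j) * v j))\<^sup>2) \<le> (\<Sum>j<n'. (cmod (v j))\<^sup>2)"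
    unfolding split[OF k_le(2), of "\<lambda>j. (cmod (v j))\<^sup>2"] .
qed

lemma quad_wt:
  fixes w p z S T
  defines "y \<equiv> z * (\<Sum>i<n. cnj (w i) * (\<Sum>j<n'. V $$ (i, j) * w (n + j)))"
  shows "(\<Sum>i<n + n'. \<Sum>j<n + n'. cnj (w i) * wt p z S T i j * w j) =
    p * (\<Sum>i<n. \<Sum>j<n. cnj (w i) * S $$ (i, j) * w j)
    + p * (\<Sum>i<n'. \<Sum>j<n'. cnj (w (n + i)) * T $$ (i, j) * w (n + j)) + (y + cnj y)"
proof -
  have 1: "(\<Sum>i<n. \<Sum>j<n. cnj (w i) * wt p z S T i j * w j) = p * (\<Sum>i<n. \<Sum>j<n. cnj (w i) * S $$ (i, j) * w j)"
    by (simp add: wt_def sum_distrib_left mult_ac)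
  have 2: "(\<Sum>i<n. \<Sum>j<n'. cnj (w i) * wt p z S T i (n + j) * w (n + j)) = y"
    by (simp add: wt_def y_def sum_distrib_left mult_ac)
  have "(\<Sum>i<n'. \<Sum>j<n. cnj (w (n + i)) * wt p z S T (n + i) j * w j)
     = (\<Sum>j<n. \<Sum>i<n'. cnj (w (n + i)) * wt p z S T (n + i) j * w j)" by (rule sum.swap)
  also have "\<dots> = cnj y"
    by (simp add: wt_def y_def sum_distrib_left mult_ac)
  finally have 3: "(\<Sum>i<n'. \<Sum>j<n. cnj (w (n + i)) * wt p z S T (n + i) j * w j) = cnj y" .
  have 4: "(\<Sum>i<n'. \<Sum>j<n'. cnj (w (n + i)) * wt p z S T (n + i) (n + j) * w (n + j))
     = p * (\<Sum>i<n'. \<Sum>j<n'. cnj (w (n + i)) * T $$ (i, j) * w (n + j))"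
    by (simp add: wt_def sum_distrib_left mult_ac)
  show ?thesis unfolding double_sum_lessThan_add 1 2 3 4 by (simp add: algebra_simps)
qed

lemma psd_on_wt_diag:
  assumes S: "psd_on {..<n} (\<lambda>i j. S $$ (i, j))" and T: "psd_on {..<n'} (\<lambda>i j. T $$ (i, j))"
  shows "psd_on {..<n + n'} (wt 1 0 S T)"
  unfolding psd_on_def quad_wt
  using psd_onD[OF S] psd_onD[OF T, of "\<lambda>j. _ (n + j)"] by (auto intro: add_nonneg_nonneg)

lemma quad_one_mat: "(\<Sum>i<m. \<Sum>j<m. cnj (w i) * 1\<^sub>m m $$ (i, j) * w j) = of_real (\<Sum>i<m. (cmod (w i))\<^sup>2)"
proof -
  have "(\<Sum>i<m. \<Sum>j<m. cnj (w i) * 1\<^sub>m m $$ (i, j) * w j) = (\<Sum>i<m. \<Sum>j<m. if i = j then cnj (w i) * w j else 0)"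
    by (intro sum.cong refl) simp
  then show ?thesis unfolding sum_norm_square_eq by simp
qed

lemma psd_on_one_mat: "psd_on {..<m} (\<lambda>i j. 1\<^sub>m m $$ (i, j))"
  unfolding psd_on_def quad_one_mat by (simp add: less_eq_complex_def sum_nonneg)

text \<open>At a vector \<open>(a, x)\<close> the form is at least the squared norm of
  \<open>a + V x\<close>, because \<open>V x\<close> is no longer than \<open>x\<close>.\<close>

lemma psd_on_wt_one: "psd_on {..<n + n'} (wt 1 1 (1\<^sub>m n) (1\<^sub>m n'))"
  unfolding psd_on_def
proof
  fix w
  define b where "b i = (\<Sum>j<n'. V $$ (i, j) * w (n + j))" for i
  have "(cmod (w i + b i))\<^sup>2 = (cmod (w i))\<^sup>2 + (cmod (b i))\<^sup>2 + 2 * Re (cnj (w i) * b i)" for i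
    unfolding cmod_power2 by (simp add: power2_eq_square algebra_simps)
  then have "(\<Sum>i<n. (cmod (w i + b i))\<^sup>2) = (\<Sum>i<n. (cmod (w i))\<^sup>2) + (\<Sum>i<n. (cmod (b i))\<^sup>2) + 2 * Re (\<Sum>i<n. cnj (w i) * b i)"
    by (simp only: sum.distrib sum_distrib_left Re_sum)
  moreover have "(\<Sum>i<n. (cmod (w i + b i))\<^sup>2) \<ge> 0" by (simp add: sum_nonneg)
  moreover have "(\<Sum>i<n. (cmod (b i))\<^sup>2) \<le> (\<Sum>j<n'. (cmod (w (n + j)))\<^sup>2)"
    using V_contraction[unfolded contraction_on_def, rule_format, of "\<lambda>j. w (n + j)"] by (simp add: b_def)
  ultimately have "0 \<le> (\<Sum>i<n. (cmod (w i))\<^sup>2) + (\<Sum>j<n'. (cmod (w (n + j)))\<^sup>2) + 2 * Re (\<Sum>i<n. cnj (w i) * b i)"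
    by linarith
  then show "0 \<le> (\<Sum>i<n+n'. \<Sum>j<n+n'. cnj (w i) * wt 1 1 (1\<^sub>m n) (1\<^sub>m n') i j * w j)"
    unfolding quad_wt quad_one_mat[where w = w] quad_one_mat[where w = "\<lambda>j. w (n + j)"] b_def[symmetric]
      complex_add_cnj by (simp add: less_eq_complex_def)
qed

lemma V_dim: "dim_row V = n" "dim_col V = n'"
  using V_carrier by auto

lemma VV_index:
  "i < n \<Longrightarrow> j < n \<Longrightarrow> (V * mat_adjoint V) $$ (i, j) = (\<Sum>l<n'. V $$ (i, l) * cnj (V $$ (j, l)))"
  "i < n' \<Longrightarrow> j < n' \<Longrightarrow> (mat_adjoint V * V) $$ (i, j) = (\<Sum>l<n. cnj (V $$ (l, i)) * V $$ (l, j))"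
  by (simp_all add: V_dim scalar_prod_def atLeast0LessThan cong: sum.cong_simp)

lemma VV_carrier: "V * mat_adjoint V \<in> carrier_mat n n" "mat_adjoint V * V \<in> carrier_mat n' n'"
  by (intro carrier_matI; simp add: V_dim)+

text \<open>A Gram matrix: the block column of \<open>V\<close> over \<open>I\<close>, times its
  adjoint.\<close>

lemma psd_on_wt_mult_adjoint: "psd_on {..<n + n'} (wt 1 1 (V * mat_adjoint V) (1\<^sub>m n'))"
proof -
  define g where "g l i = (if i < n then V $$ (i, l) else if i - n = l then 1 else 0)" for l i
  have "psd_on {..<n + n'} (\<lambda>i j. \<Sum>l<n'. g l i * cnj (g l j))"
    by (intro psd_on_sum psd_on_rank_one)
  also have "?this \<longleftrightarrow> ?thesis"
  proof (rule psd_on_cong)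
    fix i j assume "i \<in> {..<n + n'}" "j \<in> {..<n + n'}"
    then have ij: "\<not> i < n \<Longrightarrow> i - n < n'" "\<not> j < n \<Longrightarrow> j - n < n'" by auto
    show "(\<Sum>l<n'. g l i * cnj (g l j)) = wt 1 1 (V * mat_adjoint V) (1\<^sub>m n') i j"
      using ij by (cases "i < n"; cases "j < n") (simp_all add: g_def wt_def VV_index(1) sum_delta_mult)
  qed
  finally show ?thesis .
qed

text \<open>Again a Gram matrix, now of the block column of \<open>I\<close> over
  \<open>V\<^sup>*\<close>.\<close>

lemma psd_on_wt_adjoint_mult: "psd_on {..<n + n'} (wt 1 1 (1\<^sub>m n) (mat_adjoint V * V))"
proof -
  define g where "g l i = (if i < n then if i = l then 1 else 0 else cnj (V $$ (l, i - n)))" for l i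
  have "psd_on {..<n + n'} (\<lambda>i j. \<Sum>l<n. g l i * cnj (g l j))"
    by (intro psd_on_sum psd_on_rank_one)
  also have "?this \<longleftrightarrow> ?thesis"
  proof (rule psd_on_cong)
    fix i j assume "i \<in> {..<n + n'}" "j \<in> {..<n + n'}"
    then have ij: "\<not> i < n \<Longrightarrow> i - n < n'" "\<not> j < n \<Longrightarrow> j - n < n'" by auto
    show "(\<Sum>l<n. g l i * cnj (g l j)) = wt 1 1 (1\<^sub>m n) (mat_adjoint V * V) i j"
      using ij by (cases "i < n"; cases "j < n") (simp_all add: g_def wt_def VV_index(2) sum_delta_mult)
  qed
  finally show ?thesis .
qed

lemma psd_on_one_minus_VV:
  "psd_on {..<n} (\<lambda>i j. (1\<^sub>m n - V * mat_adjoint V) $$ (i, j))"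
  "psd_on {..<n'} (\<lambda>i j. (1\<^sub>m n' - mat_adjoint V * V) $$ (i, j))"
proof -
  have "(1\<^sub>m n - V * mat_adjoint V) $$ (i, j) =
      (if i = j then 1 else 0) - (\<Sum>l<n'. cnj (cnj (V $$ (i, l))) * cnj (V $$ (j, l)))"
    if "i < n" "j < n" for i j
    using that VV_carrier(1) VV_index(1)[OF that] by (simp del: index_mult_mat)
  then show "psd_on {..<n} (\<lambda>i j. (1\<^sub>m n - V * mat_adjoint V) $$ (i, j))"
    by (intro psd_on_cong[THEN iffD2, OF _ psd_on_one_minus_contraction[OF contraction_on_adjoint[OF V_contraction]]])
      (simp only: lessThan_iff)
  have "(1\<^sub>m n' - mat_adjoint V * V) $$ (i, j) =
      (if i = j then 1 else 0) - (\<Sum>l<n. cnj (V $$ (l, i)) * V $$ (l, j))"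
    if "i < n'" "j < n'" for i j
    using that VV_carrier(2) VV_index(2)[OF that] by (simp del: index_mult_mat)
  then show "psd_on {..<n'} (\<lambda>i j. (1\<^sub>m n' - mat_adjoint V * V) $$ (i, j))"
    by (intro psd_on_cong[THEN iffD2, OF _ psd_on_one_minus_contraction[OF V_contraction]])
      (simp only: lessThan_iff)
qed

text \<open>Write \<open>z = |z| u\<close> with \<open>|u| = 1\<close>. The new weight is
  \<open>|z|\<close> times the old one conjugated by the diagonal matrix with \<open>u\<close> on
  the first half and \<open>1\<close> on the second, plus \<open>p - |z|\<close> times the
  compression of the old one to its two diagonal blocks.\<close>

lemma psd_on_wt_scale:
  assumes W: "psd_on {..<n + n'} (wt 1 1 S T)" and z: "cmod z \<le> p"
  shows "psd_on {..<n + n'} (wt (of_real p) z S T)"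
proof -
  define u where "u = (if z = 0 then 1 else z / of_real (cmod z))"
  have "cmod u = 1" by (simp add: u_def norm_divide)
  then have u: "of_real (cmod z) * u = z" "of_real (cmod z) * cnj u = cnj z" "u * cnj u = 1"
    by (auto simp: complex_norm_square[symmetric]) (auto simp: u_def)
  define g where "g i = (if i < n then u else 1)" for i
  define \<chi> \<chi>' :: "nat \<Rightarrow> complex" where "\<chi> i = (if i < n then 1 else 0)" and "\<chi>' i = (if i < n then 0 else 1)" for i
  let ?W = "wt 1 1 S T"
  have "psd_on {..<n + n'} (\<lambda>i j. of_real (cmod z) * (g i * ?W i j * cnj (g j))
    + of_real (p - cmod z) * (\<chi> i * ?W i j * cnj (\<chi> j) + \<chi>' i * ?W i j * cnj (\<chi>' j)))"
    using z by (intro psd_on_add psd_on_scale psd_on_congruence W) (auto simp: less_eq_complex_def)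
  also have "?this \<longleftrightarrow> ?thesis"
  proof (rule psd_on_cong)
    fix i j
    have "of_real (cmod z) * (u * x * cnj u) = of_real (cmod z) * x" for x
      using u(3) by (simp add: mult_ac)
    moreover have "of_real (cmod z) * (u * x) = z * x" "of_real (cmod z) * (x * cnj u) = cnj z * x" for x
      using u(1,2) by (simp_all add: mult_ac)
    ultimately show "of_real (cmod z) * (g i * ?W i j * cnj (g j))
      + of_real (p - cmod z) * (\<chi> i * ?W i j * cnj (\<chi> j) + \<chi>' i * ?W i j * cnj (\<chi>' j)) = wt (of_real p) z S T i j"
      by (auto simp: wt_def g_def \<chi>_def \<chi>'_def algebra_simps)
  qed
  finally show ?thesis .
qed

text \<open>For nonzero \<open>lam\<close> this is
  \<open>1 / |t + 1 / lam| \<le> 1 / (t + 1 / c)\<close>, true because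
  \<open>Re (1 / lam) \<ge> 1 / c\<close>. Comparing squared products instead of reciprocals covers
  \<open>lam = 0\<close> and \<open>c = 0\<close> as well.\<close>

lemma transform_coeff_le:
  assumes c: "0 \<le> c" "(cmod lam)\<^sup>2 \<le> c * Re lam" and t: "0 \<le> t"
  shows "cmod (lam / (1 + of_real t * lam)) \<le> c / (1 + t * c)"
proof -
  have nz: "1 + of_real t * lam \<noteq> 0" using one_plus_nonzero[OF Re_lam t] .
  have lc: "(cmod lam)\<^sup>2 \<le> c\<^sup>2"
  proof -
    have "(cmod lam)\<^sup>2 \<le> c * cmod lam"
      using c complex_Re_le_cmod[of lam] by (meson mult_left_mono order_trans)
    then have "cmod lam \<le> c" using c(1) by (cases "cmod lam = 0") (auto simp: power2_eq_square)
    then show ?thesis by (intro power_mono) auto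
  qed
  have sq: "(cmod (1 + of_real t * lam))\<^sup>2 = 1 + 2 * t * Re lam + t\<^sup>2 * (cmod lam)\<^sup>2"
    unfolding cmod_power2 by (simp add: power2_eq_square algebra_simps)
  have "(cmod lam * (1 + t * c))\<^sup>2 = (cmod lam)\<^sup>2 + 2 * t * c * (cmod lam)\<^sup>2 + t\<^sup>2 * c\<^sup>2 * (cmod lam)\<^sup>2"
    by (simp add: power2_eq_square algebra_simps)
  also have "\<dots> \<le> c\<^sup>2 + 2 * t * c * (c * Re lam) + t\<^sup>2 * c\<^sup>2 * (cmod lam)\<^sup>2"
    using c t lc by (intro add_mono mult_left_mono) auto
  also have "\<dots> = (c * cmod (1 + of_real t * lam))\<^sup>2"
    unfolding power_mult_distrib sq by (simp add: power2_eq_square algebra_simps)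
  finally have "cmod lam * (1 + t * c) \<le> c * cmod (1 + of_real t * lam)"
    by (rule power2_le_imp_le) (simp add: c(1))
  moreover have "1 + t * c > 0" using t c(1) by (simp add: add_pos_nonneg)
  ultimately show ?thesis using nz by (simp add: norm_divide field_simps)
qed

lemma q_positive_H:
  assumes f: "\<And>A. A \<in> carrier_mat (n + n') (n + n') \<Longrightarrow> f A = H (wt (of_real c) lam S T) A"
    and c: "0 \<le> c" "(cmod lam)\<^sup>2 \<le> c * Re lam"
    and S: "\<And>i. i < k \<Longrightarrow> S $$ (i, i) = 1" and T: "\<And>i. i < k \<Longrightarrow> T $$ (i, i) = 1"
    and W: "psd_on {..<n + n'} (wt 1 1 S T)"
  shows "q_positive (n + n') f"
  unfolding q_positive_def
proof (intro conjI allI impI)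
  have "completely_positive (n + n') f"
    using transform_coeff_le[OF c, of 0] by (intro completely_positive_H[OF f] psd_on_wt_scale[OF W]) auto
  then show "linear_on_mats (n + n') (n + n') f" by (simp add: completely_positive_def)
next
  fix t :: real assume t: "0 \<le> t"
  show "completely_positive (n + n') (q_transform (n + n') f t)"
    by (rule completely_positive_H[OF q_transform_H[OF f c(1) S T t] psd_on_wt_scale[OF W transform_coeff_le[OF c t]]])
next
  fix r :: real assume ev: "eigenvalue_of_map (n + n') f (complex_of_real r)"
  show "\<not> r < 0"
  proof
    assume r: "r < 0"
    obtain A where A: "A \<in> carrier_mat (n + n') (n + n')" "A \<noteq> 0\<^sub>m (n + n') (n + n')" "f A = of_real r \<cdot>\<^sub>m A"
      using ev by (auto simp: eigenvalue_of_map_def)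
    define W where "W = wt (of_real c) lam S T"
    have HA: "H W A = of_real r \<cdot>\<^sub>m A" using A f[of A] by (simp add: W_def)
    \<comment> \<open>On an eigenvector \<open>rho\<close> is multiplied both by
      \<open>\<eta>\<close>, whose real part is nonnegative, and by \<open>r < 0\<close>, so it
      vanishes; and \<open>H W A\<close> depends on \<open>A\<close> only through
      \<open>rho\<close>.\<close>
    have "rho A x y = 0" for x y
    proof -
      have "\<eta> (of_real c) lam x y * rho A x y = rho (H W A) x y"
        unfolding W_def by (rule rho_H_wt[OF S T, symmetric])
      also have "\<dots> = of_real r * rho A x y"
        unfolding HA by (rule rho_smult[OF A(1)])
      finally have "(\<eta> (of_real c) lam x y - of_real r) * rho A x y = 0" by (simp add: algebra_simps)
      moreover have "Re (\<eta> (of_real c) lam x y) \<ge> 0" using Re_lam c by (auto simp: \<eta>_def)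
      then have "\<eta> (of_real c) lam x y - of_real r \<noteq> 0" using r by (auto simp: complex_eq_iff)
      ultimately show ?thesis by simp
    qed
    then have "H W A = 0\<^sub>m (n + n') (n + n')" by (intro eq_matI) (auto simp: H_def)
    then have "of_real r \<cdot>\<^sub>m A = 0\<^sub>m (n + n') (n + n')" using HA by simp
    then have "(of_real r \<cdot>\<^sub>m A) $$ (i, j) = 0" if "i < n + n'" "j < n + n'" for i j
      using that by simp
    then have "A = 0\<^sub>m (n + n') (n + n')"
      using A(1) r by (intro eq_matI) auto
    with A(2) show False by simp
  qed
qed

text \<open>
  The maps \<open>A \<mapsto> c \<omega>(A) S\<close> and \<open>D \<mapsto> c \<omega>(D) T\<close> give a competitor of \<open>\<phi>\<close> and \<open>\<psi>\<close> with the same corner.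
\<close>

lemma hyper_maximal_imp:
  assumes hm: "hyper_maximal n n' \<phi> \<psi> \<gamma>"
    and phi: "\<And>A. A \<in> carrier_mat n n \<Longrightarrow> \<phi> A = (\<Sum>i<k. complex_of_real (\<mu> i) * A $$ (i, i)) \<cdot>\<^sub>m 1\<^sub>m n"
    and psi: "\<And>A. A \<in> carrier_mat n' n' \<Longrightarrow> \<psi> A = (\<Sum>i<k. complex_of_real (\<mu> i) * A $$ (i, i)) \<cdot>\<^sub>m 1\<^sub>m n'"
    and c: "0 \<le> c" "c \<le> 1" "(cmod lam)\<^sup>2 \<le> c * Re lam"
    and S: "S \<in> carrier_mat n n" "\<And>i. i < k \<Longrightarrow> S $$ (i, i) = 1"
    and T: "T \<in> carrier_mat n' n'" "\<And>i. i < k \<Longrightarrow> T $$ (i, i) = 1"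
    and W: "psd_on {..<n + n'} (wt 1 1 S T)"
    and S1: "psd_on {..<n} (\<lambda>i j. (1\<^sub>m n - S) $$ (i, j))"
    and T1: "psd_on {..<n'} (\<lambda>i j. (1\<^sub>m n' - T) $$ (i, j))"
  shows "c = 1 \<and> S = 1\<^sub>m n \<and> T = 1\<^sub>m n'"
proof -
  define \<phi>' where "\<phi>' A = (of_real c * (\<Sum>i<k. complex_of_real (\<mu> i) * A $$ (i, i))) \<cdot>\<^sub>m S" for A
  define \<psi>' where "\<psi>' A = (of_real c * (\<Sum>i<k. complex_of_real (\<mu> i) * A $$ (i, i))) \<cdot>\<^sub>m T" for A
  define \<Theta> where "\<Theta> = corner_map n \<phi> \<gamma> \<psi>"
  define \<Theta>' where "\<Theta>' = corner_map n \<phi>' \<gamma> \<psi>'"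
  have lt: "i < k \<Longrightarrow> i < n" "i < k \<Longrightarrow> i < n'" for i using k_le by auto
  have \<Theta>: "\<Theta> A = H (wt (of_real 1) lam (1\<^sub>m n) (1\<^sub>m n')) A" if "A \<in> carrier_mat (n + n') (n + n')" for A
    unfolding \<Theta>_def by (rule corner_map_eq_H) (use that in \<open>auto simp: phi psi\<close>)
  have \<Theta>': "\<Theta>' A = H (wt (of_real c) lam S T) A" if "A \<in> carrier_mat (n + n') (n + n')" for A
    unfolding \<Theta>'_def by (rule corner_map_eq_H) (use that S T in \<open>auto simp: \<phi>'_def \<psi>'_def\<close>)
  have qp: "q_positive (n + n') \<Theta>"
    using hm by (simp add: hyper_maximal_def q_corner_def \<Theta>_def)
  have qp': "q_positive (n + n') \<Theta>'"
    using q_positive_H[OF \<Theta>' c(1,3) S(2) T(2) W] by simp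
  have cp: "completely_positive (n + n') (\<lambda>B. q_transform (n + n') \<Theta> t B - q_transform (n + n') \<Theta>' t B)"
    if t: "0 \<le> t" for t :: real
  proof -
    define p p' where "p = 1 / (1 + t)" and "p' = c / (1 + t * c)"
    define z where "z = lam / (1 + of_real t * lam)"
    have tc: "1 + t * c > 0" using t c(1) by (simp add: add_pos_nonneg)
    have pp': "0 \<le> p'" "p' \<le> p"
      using t c tc by (auto simp: p_def p'_def field_simps)
    have *: "q_transform (n + n') \<Theta> t B = H (wt (of_real p) z (1\<^sub>m n) (1\<^sub>m n')) B"
      "q_transform (n + n') \<Theta>' t B = H (wt (of_real p') z S T) B"
      if "B \<in> carrier_mat (n + n') (n + n')" for B :: "complex mat"
      using q_transform_H[OF \<Theta> _ _ _ t that] q_transform_H[OF \<Theta>' c(1) S(2) T(2) t that] lt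
      by (simp_all add: p_def p'_def z_def)
    \<comment> \<open>Both corners carry the same \<open>z\<close> and cancel. The diagonal blocks
      of the difference split into \<open>(p - p') I\<close> and \<open>p' (I - S)\<close>,
      respectively \<open>p' (I - T)\<close>.\<close>
    define D where "D i j = of_real (p - p') * wt 1 0 (1\<^sub>m n) (1\<^sub>m n') i j + of_real p' * wt 1 0 (1\<^sub>m n - S) (1\<^sub>m n' - T) i j" for i j
    have D: "D i j = wt (of_real p) z (1\<^sub>m n) (1\<^sub>m n') i j - wt (of_real p') z S T i j" if "i < n + n'" "j < n + n'" for i j
      using that S(1) T(1) by (auto simp: D_def wt_def algebra_simps)
    show ?thesis
    proof (rule completely_positive_H)
      show "psd_on {..<n + n'} D"
        unfolding D_def using pp'
        by (intro psd_on_add psd_on_scale psd_on_wt_diag psd_on_one_mat S1 T1) (auto simp: less_eq_complex_def)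
      fix B :: "complex mat" assume "B \<in> carrier_mat (n + n') (n + n')"
      then show "q_transform (n + n') \<Theta> t B - q_transform (n + n') \<Theta>' t B = H D B"
        by (intro eq_matI) (auto simp: * H_def D algebra_simps)
    qed
  qed
  have "linear_on_mats n n \<phi>'" "linear_on_mats n' n' \<psi>'"
    unfolding linear_on_mats_iff \<phi>'_def \<psi>'_def using S T lt
    by (auto simp: algebra_simps sum.distrib sum_distrib_left add_smult_distrib_right_mat intro!: eq_matI)
  moreover have "q_dominates (n + n') \<Theta> \<Theta>'"
    using qp qp' cp by (simp add: q_dominates_def)
  ultimately have "\<Theta> M = \<Theta>' M" if "M \<in> carrier_mat (n + n') (n + n')" for M
    using hm that unfolding hyper_maximal_def \<Theta>_def \<Theta>'_def by blast
  \<comment> \<open>At the identity matrix \<open>rho\<close> is \<open>1\<close> on both diagonal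
    blocks, so the equality reads off \<open>I = c S\<close> and \<open>I = c T\<close>; the entry
    at \<open>(0, 0)\<close>, where \<open>S\<close> is \<open>1\<close>, then gives
    \<open>c = 1\<close>.\<close>
  then have "H (wt (of_real 1) lam (1\<^sub>m n) (1\<^sub>m n')) (1\<^sub>m (n + n')) = H (wt (of_real c) lam S T) (1\<^sub>m (n + n'))"
    using \<Theta> \<Theta>' by simp
  then have eq: "H (wt (of_real 1) lam (1\<^sub>m n) (1\<^sub>m n')) (1\<^sub>m (n + n')) $$ (i, j) = H (wt (of_real c) lam S T) (1\<^sub>m (n + n')) $$ (i, j)" for i j
    by simp
  have rho1: "rho (1\<^sub>m (n + n')) x x = 1" for x
    using lt k_le by (cases x) (simp_all add: rho_blocks mu_sum_complex trans_less_add1)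
  have Sc: "(if i = j then 1 else 0) = of_real c * S $$ (i, j)" if "i < n" "j < n" for i j
    using eq[of i j] that by (simp add: H_index rho1 wt_def)
  have Tc: "(if i = j then 1 else 0) = of_real c * T $$ (i, j)" if "i < n'" "j < n'" for i j
    using eq[of "n + i" "n + j"] that by (simp add: H_index rho1 wt_def)
  have "k > 0" using mu_sum by (cases k) auto
  then have c1: "c = 1" using Sc[of 0 0] lt S(2)[of 0] by simp
  then show ?thesis using Sc Tc S(1) T(1) by (auto intro!: eq_matI)
qed

section \<open>Hyper maximality of unitary corners\<close>

text \<open>Half the value of the transform of \<open>\<Theta>\<close> at a null vector of a test
  matrix: the outcome of \<open>quad_wt_flip\<close> for \<open>p = 1 / (1 + t)\<close> and
  \<open>z = lam / (1 + t * lam)\<close>.\<close>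

definition \<epsilon> :: "real \<Rightarrow> real" where
  "\<epsilon> t = 1 / (1 + t) - Re (lam / (1 + of_real t * lam))"

text \<open>Over the denominator \<open>(1 + t) * d\<close> with \<open>d = |1 + t lam|^2\<close>,
  the equality of \<open>|lam|^2\<close> and \<open>Re lam\<close> cancels the terms in
  \<open>t\<close> and \<open>t^2\<close> of the numerator and leaves \<open>1 - Re lam\<close>;
  moreover \<open>d \<ge> t^2 * Re lam\<close>.\<close>

lemma epsilon_le:
  assumes lam: "0 < (cmod lam)\<^sup>2" "(cmod lam)\<^sup>2 = Re lam" and t: "0 < t"
  shows "\<epsilon> t \<le> 1 / (Re lam * t ^ 3)"
proof -
  define \<rho> where "\<rho> = Re lam"
  have \<rho>: "0 < \<rho>" using lam by (simp add: \<rho>_def)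
  define d where "d = 1 + 2 * t * \<rho> + t\<^sup>2 * \<rho>"
  have d: "d > 0" using \<rho> t by (simp add: d_def add_pos_nonneg)
  have sq: "(cmod (1 + of_real t * lam))\<^sup>2 = d"
  proof -
    have "(cmod (1 + of_real t * lam))\<^sup>2 = 1 + 2 * t * Re lam + t\<^sup>2 * (cmod lam)\<^sup>2"
      unfolding cmod_power2 by (simp add: power2_eq_square algebra_simps)
    then show ?thesis using lam(2) by (simp add: d_def \<rho>_def)
  qed
  have "Re (lam / (1 + of_real t * lam)) = Re (lam * cnj (1 + of_real t * lam)) / d"
    by (subst complex_div_cnj) (simp add: sq)
  also have "lam * cnj (1 + of_real t * lam) = lam + of_real (t * (cmod lam)\<^sup>2)"
    using complex_norm_square[of lam] by (simp add: algebra_simps)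
  finally have Re: "Re (lam / (1 + of_real t * lam)) = \<rho> * (1 + t) / d"
    using lam(2) by (simp add: \<rho>_def algebra_simps)
  have "\<epsilon> t = (d - \<rho> * (1 + t) * (1 + t)) / ((1 + t) * d)"
    unfolding \<epsilon>_def Re using d t by (simp add: field_simps)
  also have "d - \<rho> * (1 + t) * (1 + t) = 1 - \<rho>" by (simp add: d_def algebra_simps power2_eq_square)
  also have "(1 - \<rho>) / ((1 + t) * d) \<le> 1 / ((1 + t) * d)"
    using \<rho> d t by (intro divide_right_mono) auto
  also have "\<dots> \<le> 1 / (\<rho> * t ^ 3)"
  proof -
    have "\<rho> * t ^ 3 = t * (t\<^sup>2 * \<rho>)" by (simp add: power2_eq_square power3_eq_cube)
    also have "\<dots> \<le> (1 + t) * d" using \<rho> t by (intro mult_mono) (auto simp: d_def)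
    finally show ?thesis using \<rho> t d by (intro divide_left_mono) auto
  qed
  finally show ?thesis by (simp add: \<rho>_def)
qed

lemma rho_bound:
  obtains K where "0 \<le> K" "\<And>M \<delta> x y. (\<And>i j. i < n + n' \<Longrightarrow> j < n + n' \<Longrightarrow> cmod (M $$ (i, j)) \<le> \<delta>) \<Longrightarrow> cmod (rho M x y) \<le> K * \<delta>"
proof
  define B where "B x y = (\<Sum>l<k. \<mu> l * (\<Sum>a<n+n'. \<Sum>b<n+n'. cmod (\<kappa> l x a) * cmod (\<kappa> l y b)))" for x y
  define K where "K = B True True + B True False + B False True + B False False"
  have B0: "0 \<le> B x y" for x y
    unfolding B_def using mu_pos by (intro sum_nonneg mult_nonneg_nonneg) (auto simp: less_imp_le)
  show "0 \<le> K" using B0 by (simp add: K_def)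
  fix M \<delta> x y
  assume M: "\<And>i j. i < n + n' \<Longrightarrow> j < n + n' \<Longrightarrow> cmod (M $$ (i, j)) \<le> \<delta>"
  \<comment> \<open>There is at least one entry, so a bound \<open>\<delta>\<close> of the moduli is
    nonnegative.\<close>
  have "k > 0" using mu_sum by (cases k) auto
  then have "cmod (M $$ (0, 0)) \<le> \<delta>" using M k_le by simp
  then have "\<delta> \<ge> 0" by (rule order_trans[OF norm_ge_zero])
  have "cmod (rho M x y) \<le> (\<Sum>l<k. \<mu> l * (\<Sum>a<n+n'. \<Sum>b<n+n'. cmod (\<kappa> l x a) * \<delta> * cmod (\<kappa> l y b)))"
    unfolding rho_def
  proof (intro sum_norm_le)
    fix l assume l: "l \<in> {..<k}"
    have "cmod (\<Sum>a<n+n'. \<Sum>b<n+n'. \<kappa> l x a * M $$ (a, b) * cnj (\<kappa> l y b)) \<le> (\<Sum>a<n+n'. \<Sum>b<n+n'. cmod (\<kappa> l x a) * \<delta> * cmod (\<kappa> l y b))"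
      by (intro sum_norm_le) (auto simp: norm_mult intro!: mult_right_mono mult_left_mono M)
    then show "cmod (of_real (\<mu> l) * (\<Sum>a<n+n'. \<Sum>b<n+n'. \<kappa> l x a * M $$ (a, b) * cnj (\<kappa> l y b))) \<le> \<mu> l * (\<Sum>a<n+n'. \<Sum>b<n+n'. cmod (\<kappa> l x a) * \<delta> * cmod (\<kappa> l y b))"
      using l mu_pos[of l] by (simp add: norm_mult mult_left_mono)
  qed
  also have "\<dots> = B x y * \<delta>" unfolding B_def by (simp add: sum_distrib_left sum_distrib_right mult_ac)
  also have "\<dots> \<le> K * \<delta>" using B0 \<open>\<delta> \<ge> 0\<close> by (intro mult_right_mono) (cases x; cases y; auto simp: K_def)+
  finally show "cmod (rho M x y) \<le> K * \<delta>" .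
qed

text \<open>Here \<open>s\<close> is a sign, and \<open>w\<close> pairs \<open>u = V x\<close> with
  \<open>- s x\<close>, so that the corner term counts against the diagonal for either sign. For
  \<open>p = z = 1\<close> the form vanishes: \<open>w\<close> is a null vector of the test
  matrix.\<close>

lemma quad_wt_flip:
  assumes s: "s * s = 1" "cnj s = s" and u: "(\<Sum>i<n. (cmod (u i))\<^sup>2) = 1" and x: "(\<Sum>j<n'. (cmod (x j))\<^sup>2) = 1"
    and Vx: "\<And>i. i < n \<Longrightarrow> (\<Sum>j<n'. V $$ (i, j) * x j) = u i"
  defines "w \<equiv> \<lambda>i. if i < n then u i else - s * x (i - n)"
  shows "(\<Sum>i<n + n'. \<Sum>j<n + n'. cnj (w i) * wt p (z * s) (1\<^sub>m n) (1\<^sub>m n') i j * w j) = 2 * p - (z + cnj z)"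
proof -
  have w1: "(\<Sum>i<n. \<Sum>j<n. cnj (w i) * 1\<^sub>m n $$ (i, j) * w j) = 1"
    unfolding quad_one_mat using u by (simp add: w_def)
  have "cmod s * cmod s = 1" using s(1) by (metis norm_mult norm_one)
  then have "(cmod s)\<^sup>2 = 1" by (simp add: power2_eq_square)
  then have w2: "(\<Sum>i<n'. \<Sum>j<n'. cnj (w (n + i)) * 1\<^sub>m n' $$ (i, j) * w (n + j)) = 1"
    unfolding quad_one_mat[where w = "\<lambda>i. w (n + i)"] using x by (simp add: w_def norm_mult power_mult_distrib)
  have "(\<Sum>i<n. cnj (w i) * (\<Sum>j<n'. V $$ (i, j) * w (n + j))) = (\<Sum>i<n. - s * (cnj (u i) * u i))"
  proof (intro sum.cong refl)
    fix i assume "i \<in> {..<n}"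
    then have i: "i < n" by simp
    have "(\<Sum>j<n'. V $$ (i, j) * w (n + j)) = - s * (\<Sum>j<n'. V $$ (i, j) * x j)"
      by (simp add: w_def sum_distrib_left mult_ac sum_negf)
    then show "cnj (w i) * (\<Sum>j<n'. V $$ (i, j) * w (n + j)) = - s * (cnj (u i) * u i)"
      using i by (simp add: Vx w_def)
  qed
  also have "\<dots> = - s"
    unfolding sum_distrib_left[symmetric] sum_norm_square_eq[symmetric] u by simp
  finally have y: "z * s * (\<Sum>i<n. cnj (w i) * (\<Sum>j<n'. V $$ (i, j) * w (n + j))) = - z"
    using s(1) by (simp add: mult.assoc)
  show ?thesis unfolding quad_wt w1 w2 y by simp
qed

lemma hyper_maximalI:
  assumes qc: "q_corner n n' \<phi> \<psi> \<gamma>"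
    and phi: "\<And>A. A \<in> carrier_mat n n \<Longrightarrow> \<phi> A = (\<Sum>i<k. complex_of_real (\<mu> i) * A $$ (i, i)) \<cdot>\<^sub>m 1\<^sub>m n"
    and psi: "\<And>A. A \<in> carrier_mat n' n' \<Longrightarrow> \<psi> A = (\<Sum>i<k. complex_of_real (\<mu> i) * A $$ (i, i)) \<cdot>\<^sub>m 1\<^sub>m n'"
    and lam: "0 < (cmod lam)\<^sup>2" "(cmod lam)\<^sup>2 = Re lam"
    and VV: "V * mat_adjoint V = 1\<^sub>m n" "mat_adjoint V * V = 1\<^sub>m n'"
  shows "hyper_maximal n n' \<phi> \<psi> \<gamma>"
  unfolding hyper_maximal_def
proof (intro conjI allI impI ballI qc)
  fix \<phi>' \<psi>' and M :: "complex mat"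
  assume lin: "linear_on_mats n n \<phi>'" "linear_on_mats n' n' \<psi>'"
    and dom: "q_dominates (n + n') (corner_map n \<phi> \<gamma> \<psi>) (corner_map n \<phi>' \<gamma> \<psi>')"
    and M: "M \<in> carrier_mat (n + n') (n + n')"
  define m where "m = n + n'"
  define \<Theta> where "\<Theta> = corner_map n \<phi> \<gamma> \<psi>"
  define \<Theta>' where "\<Theta>' = corner_map n \<phi>' \<gamma> \<psi>'"
  define W where "W = wt 1 lam (1\<^sub>m n) (1\<^sub>m n')"
  have lt: "i < k \<Longrightarrow> i < n" "i < k \<Longrightarrow> i < n'" for i using k_le by auto
  have \<Theta>1: "\<Theta> A = H (wt (of_real 1) lam (1\<^sub>m n) (1\<^sub>m n')) A" if "A \<in> carrier_mat m m" for A
    unfolding \<Theta>_def by (rule corner_map_eq_H) (use that in \<open>auto simp: phi psi m_def\<close>)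
  then have \<Theta>: "\<Theta> A = H W A" if "A \<in> carrier_mat m m" for A using that by (simp add: W_def)
  have qp': "q_positive m \<Theta>'" using dom by (simp add: q_dominates_def \<Theta>'_def m_def)
  have \<Theta>'c: "\<Theta>' A \<in> carrier_mat m m" if "A \<in> carrier_mat m m" for A
    using qp' that by (simp add: q_positive_def linear_on_mats_iff)
  define D where "D t B = q_transform m \<Theta> t B - q_transform m \<Theta>' t B" for t B
  have Dcp: "completely_positive m (D t)" if "t \<ge> 0" for t
    using dom that unfolding q_dominates_def D_def \<Theta>_def \<Theta>'_def m_def by blast
  define z where "z t = lam / (1 + of_real t * lam)" for t :: real
  have tr: "q_transform m \<Theta> t N = H (wt (of_real (1 / (1 + t))) (z t) (1\<^sub>m n) (1\<^sub>m n')) N"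
    if "t \<ge> 0" "N \<in> carrier_mat m m" for t N
    using q_transform_H[of \<Theta> 1 "1\<^sub>m n" "1\<^sub>m n'" t N] \<Theta>1 that lt unfolding m_def z_def by simp
  have rhoH: "rho (H W A) x y = \<eta> 1 lam x y * rho A x y" for A x y
    unfolding W_def by (rule rho_H_wt) (auto simp: lt)
  have e0: "1 + of_real t * \<eta> 1 lam x y \<noteq> 0" if "t \<ge> 0" for t x y
    using one_plus_nonzero[OF _ that, of "\<eta> 1 lam x y"] Re_lam by (auto simp: \<eta>_def)
  have Wt: "wt (1 / (1 + of_real t)) (z t) (1\<^sub>m n) (1\<^sub>m n') i j = W i j / (1 + of_real t * \<eta> 1 lam (i < n) (j < n))" for t i j
    by (auto simp: W_def wt_def z_def \<eta>_def)
  \<comment> \<open>Unlike for \<open>\<Theta>\<close>, this transform is known only through a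
    preimage under \<open>I + t \<Theta>'\<close>.\<close>
  have tr': "\<exists>A \<in> carrier_mat m m. A + of_real t \<cdot>\<^sub>m \<Theta>' A = N \<and> q_transform m \<Theta>' t N = \<Theta>' A"
    if t: "t \<ge> 0" and N: "N \<in> carrier_mat m m" for t N
  proof -
    note b = q_positive_bij[OF qp' t]
    obtain A where A: "A \<in> carrier_mat m m" "A + of_real t \<cdot>\<^sub>m \<Theta>' A = N"
      using b(2) N by (metis (no_types, lifting) imageE)
    then show ?thesis using q_transform_eqI[OF b(1) A] by blast
  qed
  \<comment> \<open>On an off-diagonal block \<open>\<Theta>'\<close> acts as \<open>H W\<close>, so
    the preimage satisfies \<open>rho A = rho N / (1 + t \<eta>)\<close> there, just as for
    \<open>\<Theta>\<close>: the corner alone determines these blocks of both transforms.\<close>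
  have off: "D t N $$ (i, j) = 0"
    if t: "t \<ge> 0" and N: "N \<in> carrier_mat m m" and ij: "i < m" "j < m" "(i < n) \<noteq> (j < n)" for t N i j
  proof -
    obtain A where A: "A \<in> carrier_mat m m" "A + of_real t \<cdot>\<^sub>m \<Theta>' A = N" "q_transform m \<Theta>' t N = \<Theta>' A"
      using tr'[OF t N] by blast
    have off': "\<Theta>' A $$ (a, b) = H W A $$ (a, b)" if ab: "a < m" "b < m" "(a < n) \<noteq> (b < n)" for a b
    proof -
      have "\<Theta>' A $$ (a, b) = \<Theta> A $$ (a, b)"
        unfolding \<Theta>_def \<Theta>'_def
        by (rule corner_map_off_diagonal[where n' = n'])
          (use A(1) lin ab in \<open>auto simp: m_def phi psi linear_on_mats_iff\<close>)
      then show ?thesis using \<Theta>[OF A(1)] by simp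
    qed
    have "rho N (i < n) (j < n) = rho A (i < n) (j < n) + of_real t * rho (\<Theta>' A) (i < n) (j < n)"
      unfolding A(2)[symmetric] using A(1) \<Theta>'c[OF A(1)] by (intro rho_add_scale) (auto simp: m_def)
    also have "rho (\<Theta>' A) (i < n) (j < n) = rho (H W A) (i < n) (j < n)"
      using off' ij(3) by (intro rho_cong) (auto simp: m_def)
    finally have "rho N (i < n) (j < n) = (1 + of_real t * \<eta> 1 lam (i < n) (j < n)) * rho A (i < n) (j < n)"
      by (simp add: rhoH algebra_simps)
    then have r: "rho A (i < n) (j < n) = rho N (i < n) (j < n) / (1 + of_real t * \<eta> 1 lam (i < n) (j < n))"
      using e0[OF t, of "i < n" "j < n"] by (simp add: field_simps)
    have ij': "i < n + n'" "j < n + n'" using ij by (simp_all add: m_def)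
    have "q_transform m \<Theta> t N $$ (i, j) = W i j * rho A (i < n) (j < n)"
      unfolding tr[OF t N] H_index[OF ij'] r by (simp add: Wt)
    also have "\<dots> = \<Theta>' A $$ (i, j)"
      unfolding off'[OF ij] H_index[OF ij'] ..
    finally have "q_transform m \<Theta> t N $$ (i, j) = \<Theta>' A $$ (i, j)" .
    then show ?thesis
      unfolding D_def A(3) using ij \<Theta>'c[OF A(1)] by simp
  qed
  have lin_D: "linear_on_mats m m (D t)" if "t \<ge> 0" for t
    using Dcp[OF that] by (simp add: completely_positive_def)
  have D1_bound: "(\<Sum>i<n. \<Sum>j<n. cnj (u i) * D t (1\<^sub>m m) $$ (i, j) * u j)
      + (\<Sum>i<n'. \<Sum>j<n'. cnj (x i) * D t (1\<^sub>m m) $$ (n + i, n + j) * x j) \<le> of_real (2 * \<epsilon> t)"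
    if t: "t \<ge> 0" and u: "(\<Sum>i<n. (cmod (u i))\<^sup>2) = 1" and x: "(\<Sum>j<n'. (cmod (x j))\<^sup>2) = 1"
      and Vx: "\<And>i. i < n \<Longrightarrow> (\<Sum>j<n'. V $$ (i, j) * x j) = u i" for t u x
  proof -
    define P where "P s = mat m m (\<lambda>(i, j). wt 1 s (1\<^sub>m n) (1\<^sub>m n') i j)" for s
    define q where "q A = (\<Sum>i<n. \<Sum>j<n. cnj (u i) * A $$ (i, j) * u j)
      + (\<Sum>i<n'. \<Sum>j<n'. cnj (x i) * A $$ (n + i, n + j) * x j)" for A
    have P: "P s \<in> carrier_mat m m" for s by (simp add: P_def)
    \<comment> \<open>The transform of \<open>\<Theta>'\<close> is positive at \<open>P s\<close>,
      so the form of \<open>D t (P s)\<close> is at most that of the transform of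
      \<open>\<Theta>\<close>, which equals \<open>2 * \<epsilon> t\<close> at the null vector
      \<open>w\<close> of \<open>P s\<close>.\<close>
    have le: "q (D t (P s)) \<le> of_real (2 * \<epsilon> t)" if s: "s * s = 1" "cnj s = s" for s
    proof -
      define w where "w = (\<lambda>i. if i < n then u i else - s * x (i - n))"
      have "cmod s * cmod s = 1" using s(1) by (metis norm_mult norm_one)
      then have "(cmod s)\<^sup>2 = 1" by (simp add: power2_eq_square)
      then have s1: "cmod s = 1" by (simp add: abs_square_eq_1)
      have "psd_on {..<m} (wt (of_real 1) s (1\<^sub>m n) (1\<^sub>m n'))"
        unfolding m_def by (rule psd_on_wt_scale[OF psd_on_wt_one]) (simp add: s1)
      then have "psd_on {..<m} (\<lambda>i j. P s $$ (i, j))"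
        by (rule psd_on_cong[THEN iffD1, rotated]) (simp add: P_def)
      then have pP: "positive_mat m (P s)" by (simp add: positive_mat_iff_psd_on P)
      have "completely_positive m (q_transform m \<Theta>' t)"
        using qp' t by (simp add: q_positive_def)
      then have "positive_mat m (q_transform m \<Theta>' t (P s))"
        using pP by (rule completely_positive_imp_positive)
      then have psd': "0 \<le> (\<Sum>i<m. \<Sum>j<m. cnj (w i) * q_transform m \<Theta>' t (P s) $$ (i, j) * w j)"
        and carr: "q_transform m \<Theta>' t (P s) \<in> carrier_mat m m"
        by (simp_all add: positive_mat_iff_psd_on psd_on_def)
      have Pt: "q_transform m \<Theta> t (P s) $$ (i, j) = wt (of_real (1 / (1 + t))) (z t * s) (1\<^sub>m n) (1\<^sub>m n') i j"
        if "i < m" "j < m" for i j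
      proof -
        have "rho (P s) a b = \<eta> 1 s a b" for a b
          unfolding P_def m_def by (rule rho_wt) (auto simp: lt)
        then show ?thesis
          unfolding tr[OF t P] using that s(2) by (simp add: H_index m_def wt_def \<eta>_def)
      qed
      have "(\<Sum>i<m. \<Sum>j<m. cnj (w i) * q_transform m \<Theta> t (P s) $$ (i, j) * w j)
        = (\<Sum>i<m. \<Sum>j<m. cnj (w i) * wt (of_real (1 / (1 + t))) (z t * s) (1\<^sub>m n) (1\<^sub>m n') i j * w j)"
        by (simp add: Pt)
      also have "\<dots> = 2 * of_real (1 / (1 + t)) - (z t + cnj (z t))"
        unfolding m_def w_def by (rule quad_wt_flip[OF s u x Vx])
      also have "\<dots> = of_real (2 * \<epsilon> t)"
        unfolding complex_add_cnj \<epsilon>_def z_def by simp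
      finally have Q: "(\<Sum>i<m. \<Sum>j<m. cnj (w i) * q_transform m \<Theta> t (P s) $$ (i, j) * w j) = of_real (2 * \<epsilon> t)" .
      have "(\<Sum>i<m. \<Sum>j<m. cnj (w i) * D t (P s) $$ (i, j) * w j)
        = of_real (2 * \<epsilon> t) - (\<Sum>i<m. \<Sum>j<m. cnj (w i) * q_transform m \<Theta>' t (P s) $$ (i, j) * w j)"
        unfolding Q[symmetric] sum_subtractf[symmetric] D_def using carr
        by (intro sum.cong refl) (simp add: algebra_simps)
      then have "(\<Sum>i<m. \<Sum>j<m. cnj (w i) * D t (P s) $$ (i, j) * w j) \<le> of_real (2 * \<epsilon> t)"
        using psd' by (simp only: diff_le_eq le_add_same_cancel1)
      also have "(\<Sum>i<m. \<Sum>j<m. cnj (w i) * D t (P s) $$ (i, j) * w j) = q (D t (P s))"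
      proof -
        \<comment> \<open>The cross terms vanish, and in the diagonal blocks the sign occurs twice;
          so \<open>s\<close> drops out of the form.\<close>
        have z: "D t (P s) $$ (i, n + j) = 0" "D t (P s) $$ (n + j, i) = 0" if "i < n" "j < n'" for i j
          using off[OF t P, of i "n + j"] off[OF t P, of "n + j" i] that by (simp_all add: m_def)
        have ss: "cnj (s * a) * b * (s * c) = cnj a * b * c" for a b c
        proof -
          have "cnj (s * a) * b * (s * c) = s * s * (cnj a * b * c)" using s(2) by (simp add: mult_ac)
          then show ?thesis using s(1) by simp
        qed
        have "(\<Sum>i<n. \<Sum>j<n'. cnj (w i) * D t (P s) $$ (i, n + j) * w (n + j)) = 0"
          "(\<Sum>i<n'. \<Sum>j<n. cnj (w (n + i)) * D t (P s) $$ (n + i, j) * w j) = 0"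
          by (simp_all add: z)
        moreover have "(\<Sum>i<n. \<Sum>j<n. cnj (w i) * D t (P s) $$ (i, j) * w j)
            = (\<Sum>i<n. \<Sum>j<n. cnj (u i) * D t (P s) $$ (i, j) * u j)"
          by (simp add: w_def)
        moreover have "(\<Sum>i<n'. \<Sum>j<n'. cnj (w (n + i)) * D t (P s) $$ (n + i, n + j) * w (n + j))
            = (\<Sum>i<n'. \<Sum>j<n'. cnj (x i) * D t (P s) $$ (n + i, n + j) * x j)"
          using ss by (intro sum.cong refl) (simp add: w_def)
        ultimately show ?thesis
          unfolding m_def double_sum_lessThan_add q_def by simp
      qed
      finally show ?thesis .
    qed
    have DP: "D t (P s) \<in> carrier_mat m m" for s using lin_D[OF t, unfolded linear_on_mats_iff] P by blast
    \<comment> \<open>Averaging over both signs removes the corner and leaves the identity.\<close>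
    have P2: "P 1 + P (-1) = 2 \<cdot>\<^sub>m 1\<^sub>m m"
      by (rule eq_matI) (auto simp: P_def wt_def m_def)
    note linD = lin_D[OF t, unfolded linear_on_mats_iff]
    have D1: "D t (1\<^sub>m m) \<in> carrier_mat m m" using linD one_carrier_mat by blast
    have "2 \<cdot>\<^sub>m D t (1\<^sub>m m) = D t (2 \<cdot>\<^sub>m 1\<^sub>m m)" using linD one_carrier_mat[of m] by simp
    also have "\<dots> = D t (P 1) + D t (P (-1))" unfolding P2[symmetric] using linD P by blast
    finally have sum: "2 \<cdot>\<^sub>m D t (1\<^sub>m m) = D t (P 1) + D t (P (-1))" .
    have e: "2 * D t (1\<^sub>m m) $$ (i, j) = D t (P 1) $$ (i, j) + D t (P (-1)) $$ (i, j)" if "i < m" "j < m" for i j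
      using arg_cong[OF sum, of "\<lambda>A. A $$ (i, j)"] carrier_matD[OF D1] carrier_matD[OF DP[of "-1"]] that by simp
    have e1: "2 * D t (1\<^sub>m m) $$ (i, j) = D t (P 1) $$ (i, j) + D t (P (-1)) $$ (i, j)" if "i < n" "j < n" for i j
      using that by (intro e) (simp_all add: m_def)
    have e2: "2 * D t (1\<^sub>m m) $$ (n + i, n + j) = D t (P 1) $$ (n + i, n + j) + D t (P (-1)) $$ (n + i, n + j)" if "i < n'" "j < n'" for i j
      using that by (intro e) (simp_all add: m_def)
    have "2 * q (D t (1\<^sub>m m)) = q (D t (P 1)) + q (D t (P (-1)))"
    proof -
      have "2 * q (D t (1\<^sub>m m)) = (\<Sum>i<n. \<Sum>j<n. cnj (u i) * (2 * D t (1\<^sub>m m) $$ (i, j)) * u j)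
        + (\<Sum>i<n'. \<Sum>j<n'. cnj (x i) * (2 * D t (1\<^sub>m m) $$ (n + i, n + j)) * x j)"
        unfolding q_def by (simp add: algebra_simps sum_distrib_left)
      also have "\<dots> = q (D t (P 1)) + q (D t (P (-1)))"
      proof -
        have "(\<Sum>i<n. \<Sum>j<n. cnj (u i) * (2 * D t (1\<^sub>m m) $$ (i, j)) * u j) =
            (\<Sum>i<n. \<Sum>j<n. cnj (u i) * D t (P 1) $$ (i, j) * u j + cnj (u i) * D t (P (-1)) $$ (i, j) * u j)"
          by (intro sum.cong refl) (simp add: e1 distrib_left distrib_right)
        moreover have "(\<Sum>i<n'. \<Sum>j<n'. cnj (x i) * (2 * D t (1\<^sub>m m) $$ (n + i, n + j)) * x j) =
            (\<Sum>i<n'. \<Sum>j<n'. cnj (x i) * D t (P 1) $$ (n + i, n + j) * x j + cnj (x i) * D t (P (-1)) $$ (n + i, n + j) * x j)"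
          by (intro sum.cong refl) (simp add: e2 distrib_left distrib_right)
        ultimately show ?thesis unfolding q_def by (simp add: sum.distrib)
      qed
      finally show ?thesis .
    qed
    also have "\<dots> \<le> of_real (2 * \<epsilon> t) + of_real (2 * \<epsilon> t)"
      by (intro add_mono le) auto
    finally have "2 * q (D t (1\<^sub>m m)) \<le> of_real (2 * \<epsilon> t) + of_real (2 * \<epsilon> t)" .
    then have "q (D t (1\<^sub>m m)) \<le> of_real (2 * \<epsilon> t)" by (simp add: less_eq_complex_def)
    then show ?thesis by (simp add: q_def)
  qed
  have D1_diag: "Re (D t (1\<^sub>m m) $$ (i, i)) \<le> 2 * \<epsilon> t" if t: "t \<ge> 0" and i: "i < m" for t i
  proof -
    have "positive_mat m (1\<^sub>m m)" by (simp add: positive_mat_iff_psd_on psd_on_one_mat)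
    then have "positive_mat m (D t (1\<^sub>m m))"
      by (rule completely_positive_imp_positive[OF Dcp[OF t]])
    then have psd: "psd_on {..<m} (\<lambda>i j. D t (1\<^sub>m m) $$ (i, j))"
      by (simp add: positive_mat_iff_psd_on)
    have psd1: "psd_on {..<n} (\<lambda>i j. D t (1\<^sub>m m) $$ (i, j))"
      by (rule psd_on_subset[OF psd]) (auto simp: m_def)
    have psd2: "psd_on {..<n'} (\<lambda>i j. D t (1\<^sub>m m) $$ (n + i, n + j))"
      unfolding psd_on_def
    proof
      fix v
      show "0 \<le> (\<Sum>i<n'. \<Sum>j<n'. cnj (v i) * D t (1\<^sub>m m) $$ (n + i, n + j) * v j)"
        using psd_onD[OF psd, of "\<lambda>i. if i < n then 0 else v (i - n)"]
        unfolding m_def double_sum_lessThan_add by simp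
    qed
    have VV1: "(\<Sum>j<n'. V $$ (a, j) * cnj (V $$ (b, j))) = (if a = b then 1 else 0)" if "a < n" "b < n" for a b
      using arg_cong[OF VV(1), of "\<lambda>A. A $$ (a, b)"] that by (simp add: V_dim scalar_prod_def atLeast0LessThan cong: sum.cong_simp)
    have VV2: "(\<Sum>j<n. cnj (V $$ (j, a)) * V $$ (j, b)) = (if a = b then 1 else 0)" if "a < n'" "b < n'" for a b
      using arg_cong[OF VV(2), of "\<lambda>A. A $$ (a, b)"] that by (simp add: V_dim scalar_prod_def atLeast0LessThan cong: sum.cong_simp)
    have unit: "(\<Sum>a<r. \<Sum>b<r. cnj (if a = i then 1 else 0) * F a b * (if b = i then 1 else 0)) = F i i"
      if "i < r" for i r and F :: "nat \<Rightarrow> nat \<Rightarrow> complex"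
    proof -
      have "(\<Sum>b<r. cnj (if a = i then 1 else 0) * F a b * (if b = i then 1 else 0)) = (if a = i then F i i else 0)" for a
      proof -
        have "(\<Sum>b<r. cnj (if a = i then 1 else 0) * F a b * (if b = i then 1 else 0))
            = (\<Sum>b<r. if b = i then if a = i then F i i else 0 else 0)"
          by (intro sum.cong refl) simp
        then show ?thesis using that by simp
      qed
      then show ?thesis using that by simp
    qed
    have norm1: "(\<Sum>a<r. (cmod (if a = i then 1 else 0))\<^sup>2) = 1" if "i < r" for i r :: nat
    proof -
      have "(\<Sum>a<r. (cmod (if a = i then 1 else 0))\<^sup>2) = (\<Sum>a<r. if a = i then 1 else 0)"
        by (intro sum.cong refl) simp
      then show ?thesis using that by simp
    qed
    show ?thesis
    proof (cases "i < n")
      case True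
      define x where "x = (\<lambda>j. cnj (V $$ (i, j)))"
      have "complex_of_real (\<Sum>j<n'. (cmod (x j))\<^sup>2) = 1"
        unfolding sum_norm_square_eq using VV1[OF True True] by (simp add: x_def)
      then have x: "(\<Sum>j<n'. (cmod (x j))\<^sup>2) = 1" by (simp only: of_real_eq_1_iff)
      have Vx: "(\<Sum>j<n'. V $$ (a, j) * x j) = (if a = i then 1 else 0)" if "a < n" for a
        unfolding x_def by (rule VV1[OF that True])
      have "D t (1\<^sub>m m) $$ (i, i) + (\<Sum>i<n'. \<Sum>j<n'. cnj (x i) * D t (1\<^sub>m m) $$ (n + i, n + j) * x j) \<le> of_real (2 * \<epsilon> t)"
        using D1_bound[OF t norm1[OF True] x Vx] unfolding unit[OF True] .
      with psd_onD[OF psd2, of x] show ?thesis by (simp add: less_eq_complex_def)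
    next
      case False
      define l where "l = i - n"
      have l: "l < n'" "i = n + l" using False i by (auto simp: l_def m_def)
      define u where "u = (\<lambda>i. V $$ (i, l))"
      have "complex_of_real (\<Sum>j<n. (cmod (u j))\<^sup>2) = 1"
        unfolding sum_norm_square_eq using VV2[OF l(1) l(1)] by (simp add: u_def)
      then have u: "(\<Sum>j<n. (cmod (u j))\<^sup>2) = 1" by (simp only: of_real_eq_1_iff)
      have Vu: "(\<Sum>j<n'. V $$ (a, j) * (if j = l then 1 else 0)) = u a" for a
        using sum_delta_mult(1)[OF l(1), of "\<lambda>j. V $$ (a, j)"] by (simp only: u_def eq_commute[of l])
      have "(\<Sum>i<n. \<Sum>j<n. cnj (u i) * D t (1\<^sub>m m) $$ (i, j) * u j) + D t (1\<^sub>m m) $$ (n + l, n + l) \<le> of_real (2 * \<epsilon> t)"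
        using D1_bound[OF t u norm1[OF l(1)] Vu] unfolding unit[OF l(1)] .
      with psd_onD[OF psd1, of u] show ?thesis unfolding l(2) by (simp add: less_eq_complex_def)
    qed
  qed
  define S where "S A = (\<Sum>a<m. \<Sum>b<m. cmod (A $$ (a, b)))" for A :: "complex mat"
  have S0: "S A \<ge> 0" for A by (auto simp: S_def intro!: sum_nonneg)
  have D_bound: "cmod (D t N $$ (i, j)) \<le> S N * (2 * \<epsilon> t)"
    if t: "t \<ge> 0" and N: "N \<in> carrier_mat m m" and ij: "i < m" "j < m" for t N i j
  proof -
    have "2 * cmod (D t N $$ (i, j)) \<le> S N * (Re (D t (1\<^sub>m m) $$ (i, i)) + Re (D t (1\<^sub>m m) $$ (j, j)))"
      unfolding S_def by (rule completely_positive_entry_bound[OF Dcp[OF t] N ij])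
    also have "\<dots> \<le> S N * (2 * \<epsilon> t + 2 * \<epsilon> t)"
      by (intro mult_left_mono add_mono D1_diag t ij S0)
    finally show ?thesis by simp
  qed
  define R where "R = \<Theta>' M"
  have Mm: "M \<in> carrier_mat m m" and Rm: "R \<in> carrier_mat m m"
    using M \<Theta>'c by (auto simp: m_def R_def)
  obtain K where K: "0 \<le> K" "\<And>A \<delta> x y. (\<And>i j. i < m \<Longrightarrow> j < m \<Longrightarrow> cmod (A $$ (i, j)) \<le> \<delta>) \<Longrightarrow> cmod (rho A x y) \<le> K * \<delta>"
    using rho_bound unfolding m_def by metis
  have "\<Theta> M = R"
  proof (rule eq_matI)
    fix i j assume "i < dim_row R" "j < dim_col R"
    then have ij: "i < m" "j < m" using Rm by auto
    \<comment> \<open>The factor with \<open>K\<close> accounts for applying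
      \<open>I + t \<Theta>\<close>, \<open>S M + S R\<close> for the size of \<open>N\<close>, and
      \<open>2 / Re lam\<close> for \<open>epsilon_le\<close>.\<close>
    define C where "C = (1 + cmod (W i j) * K) * ((S M + S R) * (2 / Re lam))"
    have bound: "cmod (\<Theta> M $$ (i, j) - R $$ (i, j)) \<le> C / t" if t: "t \<ge> 1" for t
    proof -
      \<comment> \<open>\<open>N\<close> is the image of \<open>M\<close> under
        \<open>I + t \<Theta>'\<close>, so the transform of \<open>\<Theta>'\<close> at
        \<open>N\<close> is \<open>R\<close> by construction.\<close>
      define N where "N = M + of_real t \<cdot>\<^sub>m R"
      define B where "B = q_transform m \<Theta> t N"
      have t0: "t \<ge> 0" "t > 0" using t by auto
      have N: "N \<in> carrier_mat m m" using Mm Rm by (simp add: N_def)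
      have B: "B = H (wt (of_real (1 / (1 + t))) (z t) (1\<^sub>m n) (1\<^sub>m n')) N"
        unfolding B_def by (rule tr[OF t0(1) N])
      have Bm: "B \<in> carrier_mat m m" by (simp add: B m_def)
      have "q_transform m \<Theta>' t N = R"
        unfolding R_def by (rule q_transform_eqI[OF q_positive_bij(1)[OF qp' t0(1)] Mm]) (simp add: N_def R_def)
      then have DN: "D t N = B - R" by (simp add: D_def B_def)
      have rhoB: "rho B x y = rho (H W N) x y / (1 + of_real t * \<eta> 1 lam x y)" for x y
      proof -
        have "rho B x y = rho ((1 / (1 + of_real t * \<eta> 1 lam x y)) \<cdot>\<^sub>m H W N) x y"
          unfolding B using carrier_matD[OF H_carrier[of W N]] by (intro rho_cong) (auto simp: H_index Wt)
        then show ?thesis by (simp add: rho_smult)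
      qed
      \<comment> \<open>the entry form of \<open>\<Theta> - \<Theta>' = (I + t\<Theta>) D\<^sub>t (I + t\<Theta>')\<close>, since \<open>N = (I + t\<Theta>') M\<close>\<close>
      have split: "D t N $$ (i, j) + of_real t * (W i j * rho (D t N) (i < n) (j < n)) = \<Theta> M $$ (i, j) - R $$ (i, j)"
      proof -
        define x y where "x = (i < n)" and "y = (j < n)"
        define e where "e = \<eta> 1 lam x y"
        have e: "1 + of_real t * e \<noteq> 0" unfolding e_def by (rule e0[OF t0(1)])
        have rD: "rho (D t N) x y = rho B x y - rho R x y"
        proof -
          have "D t N = B + (-1) \<cdot>\<^sub>m R" unfolding DN using Bm Rm by (intro eq_matI) auto
          then show ?thesis using rho_add_scale[of B R "-1" x y] Bm Rm by (simp add: m_def)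
        qed
        have rB: "rho B x y = e * rho N x y / (1 + of_real t * e)"
          by (simp add: rhoB rhoH e_def)
        have rN: "rho N x y = rho M x y + of_real t * rho R x y"
          unfolding N_def using rho_add_scale[of M R "of_real t" x y] Mm Rm by (simp add: m_def)
        have DN_ij: "D t N $$ (i, j) = B $$ (i, j) - R $$ (i, j)"
          unfolding DN using ij Bm Rm by simp
        have B_ij: "B $$ (i, j) = W i j * rho N x y / (1 + of_real t * e)"
          unfolding B using ij by (simp add: H_index m_def Wt x_def y_def e_def)
        have M_ij: "\<Theta> M $$ (i, j) = W i j * rho M x y"
          unfolding \<Theta>[OF Mm] using ij by (simp add: H_index m_def x_def y_def)
        have "W i j * rho N x y / (1 + of_real t * e) + of_real t * (W i j * (e * rho N x y / (1 + of_real t * e)))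
            = W i j * rho N x y"
          using e by (simp add: divide_simps) (simp add: algebra_simps)
        then have "D t N $$ (i, j) + of_real t * (W i j * rho (D t N) x y)
            = W i j * rho N x y - R $$ (i, j) - of_real t * (W i j * rho R x y)"
          unfolding DN_ij B_ij rD rB by (simp only: right_diff_distrib) (simp add: algebra_simps)
        then show ?thesis unfolding M_ij rN x_def[symmetric] y_def[symmetric] by (simp add: algebra_simps)
      qed
      \<comment> \<open>\<open>N\<close> grows at most linearly in \<open>t\<close> while
        \<open>\<epsilon> t\<close> decays like \<open>t^-3\<close>, which leaves
        \<open>t^-2\<close>; the further factor \<open>t\<close> from \<open>I + t \<Theta>\<close>
        still leaves \<open>1 / t\<close>.\<close>
      have \<delta>: "cmod (D t N $$ (a, b)) \<le> (S M + S R) * (2 / Re lam) / t\<^sup>2" if "a < m" "b < m" for a b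
      proof -
        have "S N \<le> S M + t * S R"
        proof -
          have "S N \<le> (\<Sum>a<m. \<Sum>b<m. cmod (M $$ (a, b)) + t * cmod (R $$ (a, b)))"
            unfolding S_def N_def using Mm Rm t0
            by (intro sum_mono) (auto intro!: order_trans[OF norm_triangle_ineq] simp: norm_mult)
          also have "\<dots> = S M + t * S R" by (simp add: S_def sum.distrib sum_distrib_left)
          finally show ?thesis .
        qed
        also have "\<dots> \<le> t * (S M + S R)"
          using t S0[of M] mult_right_mono[of 1 t "S M"] by (simp add: algebra_simps)
        finally have SN: "S N \<le> t * (S M + S R)" .
        have "cmod (D t N $$ (a, b)) \<le> S N * (2 * \<epsilon> t)" by (rule D_bound[OF t0(1) N that])
        also have "\<dots> \<le> S N * (2 * (1 / (Re lam * t ^ 3)))"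
          using epsilon_le[OF lam t0(2)] S0 by (intro mult_left_mono) auto
        also have "\<dots> \<le> t * (S M + S R) * (2 * (1 / (Re lam * t ^ 3)))"
          using SN lam t0 Re_lam by (intro mult_right_mono) auto
        also have "\<dots> = (S M + S R) * (2 / Re lam) / t\<^sup>2"
          using t0 lam by (simp add: field_simps power2_eq_square power3_eq_cube)
        finally show ?thesis .
      qed
      have "cmod (\<Theta> M $$ (i, j) - R $$ (i, j)) \<le>
          cmod (D t N $$ (i, j)) + t * (cmod (W i j) * cmod (rho (D t N) (i < n) (j < n)))"
        using norm_triangle_ineq[of "D t N $$ (i, j)" "of_real t * (W i j * rho (D t N) (i < n) (j < n))"] t0
        unfolding split[symmetric] by (simp add: norm_mult)
      also have "\<dots> \<le> (S M + S R) * (2 / Re lam) / t\<^sup>2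
          + t * (cmod (W i j) * (K * ((S M + S R) * (2 / Re lam) / t\<^sup>2)))"
        by (intro add_mono mult_left_mono \<delta> ij K(2)) (use t0 in auto)
      also have "\<dots> \<le> t * ((S M + S R) * (2 / Re lam) / t\<^sup>2)
          + t * (cmod (W i j) * (K * ((S M + S R) * (2 / Re lam) / t\<^sup>2)))"
      proof -
        have "0 \<le> (S M + S R) * (2 / Re lam) / t\<^sup>2" using S0[of M] S0[of R] Re_lam by simp
        from mult_right_mono[OF t this] show ?thesis by (intro add_right_mono) (simp only: mult_1)
      qed
      also have "\<dots> = C / t"
      proof -
        have "t * (a / t\<^sup>2) + t * (b * (K * (a / t\<^sup>2))) = (1 + b * K) * a / t" for a b
          using t0 by (simp add: field_simps power2_eq_square)
        then show ?thesis unfolding C_def .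
      qed
      finally show ?thesis .
    qed
    define r where "r = cmod (\<Theta> M $$ (i, j) - R $$ (i, j))"
    have "r = 0"
    proof (rule ccontr)
      assume "r \<noteq> 0"
      then have r: "r > 0" by (simp add: r_def)
      \<comment> \<open>This yields \<open>r * t \<ge> C + r\<close> against
        \<open>r * t \<le> C\<close>; the maximum with \<open>1\<close> stays in the range of
        \<open>bound\<close>.\<close>
      define t where "t = max 1 (C / r + 1)"
      have "r \<le> C / t" unfolding r_def by (rule bound) (simp add: t_def)
      then have "r * t \<le> C" by (simp add: t_def pos_le_divide_eq)
      moreover have "r * t \<ge> r * (C / r + 1)" using r by (intro mult_left_mono) (auto simp: t_def)
      ultimately show False using r by (simp add: algebra_simps)
    qed
    then show "\<Theta> M $$ (i, j) = R $$ (i, j)" by (simp add: r_def)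
  qed (use Rm \<Theta>[OF Mm] carrier_matD[OF H_carrier[of W M]] in \<open>auto simp: m_def\<close>)
  then show "corner_map n \<phi> \<gamma> \<psi> M = corner_map n \<phi>' \<gamma> \<psi>' M"
    by (simp add: \<Theta>_def R_def \<Theta>'_def)
qed

section \<open>From the matrix \<open>V\<close> to its block \<open>E\<close>\<close>

lemma V_adjoint_mult:
  "V * mat_adjoint V = four_block_mat (X * mat_adjoint X) (0\<^sub>m k (n - k)) (0\<^sub>m (n - k) k) (E * mat_adjoint E)"
  "mat_adjoint V * V = four_block_mat (mat_adjoint X * X) (0\<^sub>m k (n' - k)) (0\<^sub>m (n' - k) k) (mat_adjoint E * E)"
proof -
  have adj: "mat_adjoint V = four_block_mat (mat_adjoint X) (0\<^sub>m k (n - k)) (0\<^sub>m (n' - k) k) (mat_adjoint E)"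
    using X_carrier E_carrier carrier_matD[OF V_carrier] k_le
    by (intro eq_matI) (auto simp: V_index)
  have c: "mat_adjoint X \<in> carrier_mat k k" "mat_adjoint E \<in> carrier_mat (n' - k) (n - k)"
    using X_carrier E_carrier by (auto intro!: carrier_matI)
  show "V * mat_adjoint V = four_block_mat (X * mat_adjoint X) (0\<^sub>m k (n - k)) (0\<^sub>m (n - k) k) (E * mat_adjoint E)"
    unfolding adj unfolding V_def
    by (subst mult_four_block_mat[OF X_carrier zero_carrier_mat zero_carrier_mat E_carrier c(1) zero_carrier_mat zero_carrier_mat c(2)])
      (use X_carrier E_carrier c in \<open>simp add: right_add_zero_mat[where nr = k and nc = k] \<close>)
  show "mat_adjoint V * V = four_block_mat (mat_adjoint X * X) (0\<^sub>m k (n' - k)) (0\<^sub>m (n' - k) k) (mat_adjoint E * E)"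
    unfolding adj unfolding V_def
    by (subst mult_four_block_mat[OF c(1) zero_carrier_mat zero_carrier_mat c(2) X_carrier zero_carrier_mat zero_carrier_mat E_carrier])
      (use X_carrier E_carrier c in simp)
qed

end

theorem theorem3p7:
  fixes k n n' :: nat
    and \<mu> :: "nat \<Rightarrow> real"
    and \<phi> \<psi> \<gamma> :: "complex mat \<Rightarrow> complex mat"
    and \<Omega> X E :: "complex mat"
    and lam :: complex
  assumes mu_decreasing: "\<And>i j. i \<le> j \<Longrightarrow> j < k \<Longrightarrow> \<mu> j \<le> \<mu> i"
    and mu_pos: "\<And>i. i < k \<Longrightarrow> 0 < \<mu> i"
    and mu_sum: "(\<Sum>i<k. \<mu> i) = 1"
    and k_le: "k \<le> n" "k \<le> n'"
    and phi: "\<And>A. A \<in> carrier_mat n n \<Longrightarrow>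
      \<phi> A = (\<Sum>i<k. complex_of_real (\<mu> i) * A $$ (i, i)) \<cdot>\<^sub>m 1\<^sub>m n"
    and psi: "\<And>D. D \<in> carrier_mat n' n' \<Longrightarrow>
      \<psi> D = (\<Sum>i<k. complex_of_real (\<mu> i) * D $$ (i, i)) \<cdot>\<^sub>m 1\<^sub>m n'"
    and Omega: "\<Omega> = mat_diag k (\<lambda>i. complex_of_real (\<mu> i))"
    and corner: "q_corner n n' \<phi> \<psi> \<gamma>"
    and X: "X \<in> carrier_mat k k" "unitary_mat X" "X * \<Omega> = \<Omega> * X"
    and E: "E \<in> carrier_mat (n - k) (n' - k)" "contraction_mat E"
    and lambda: "(cmod lam)\<^sup>2 \<le> Re lam"
    and gamma: "\<And>B W Q Y. B \<in> carrier_mat k k \<Longrightarrow> W \<in> carrier_mat k (n' - k) \<Longrightarrow>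
      Q \<in> carrier_mat (n - k) k \<Longrightarrow> Y \<in> carrier_mat (n - k) (n' - k) \<Longrightarrow>
      \<gamma> (four_block_mat B W Q Y) =
        (lam * mat_trace (mat_adjoint X * B * \<Omega>)) \<cdot>\<^sub>m
          four_block_mat X (0\<^sub>m k (n' - k)) (0\<^sub>m (n - k) k) E"
  shows "hyper_maximal n n' \<phi> \<psi> \<gamma> \<longleftrightarrow>
    n = n' \<and> 0 < (cmod lam)\<^sup>2 \<and> (cmod lam)\<^sup>2 = Re lam \<and> unitary_mat E"
proof -
  have Xd: "dim_row X = k" "dim_col X = k" using X(1) by auto
  have XX: "mat_adjoint X * X = 1\<^sub>m k" "X * mat_adjoint X = 1\<^sub>m k"
    using X(2) Xd by (auto simp: unitary_mat_def)
  have X_col: "(\<Sum>a<k. cnj (X $$ (a, i)) * X $$ (a, j)) = (if i = j then 1 else 0)" if "i < k" "j < k" for i j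
    using arg_cong[OF XX(1), of "\<lambda>A. A $$ (i, j)"] that
    by (simp add: Xd scalar_prod_def atLeast0LessThan cong: sum.cong_simp)
  have X_row: "(\<Sum>a<k. X $$ (i, a) * cnj (X $$ (j, a))) = (if i = j then 1 else 0)" if "i < k" "j < k" for i j
    using arg_cong[OF XX(2), of "\<lambda>A. A $$ (i, j)"] that
    by (simp add: Xd scalar_prod_def atLeast0LessThan cong: sum.cong_simp)
  have XO: "X $$ (i, a) * \<mu> a = \<mu> i * X $$ (i, a)" if "i < k" "a < k" for i a
    using arg_cong[OF X(3), of "\<lambda>A. A $$ (i, a)"] that X(1)
    by (simp add: Omega mat_diag_mult_left[OF X(1)] mat_diag_mult_right[OF X(1)] mult.commute)
  interpret corner_data k n n' \<mu> X E lam \<gamma>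
  proof
    fix i j assume ij: "i < k" "j < k"
    \<comment> \<open>By commutation \<open>\<mu> a\<close> may be replaced by
      \<open>\<mu> i\<close> in front of \<open>X $$ (i, a)\<close>, which leaves
      \<open>X X\<^sup>* = I\<close>.\<close>
    have "(\<Sum>a<k. \<mu> a * X $$ (i, a) * cnj (X $$ (j, a))) = (\<Sum>a<k. \<mu> i * (X $$ (i, a) * cnj (X $$ (j, a))))"
      using XO[OF ij(1)] by (intro sum.cong refl) (auto simp: mult_ac)
    also have "\<dots> = \<mu> i * (if i = j then 1 else 0)"
      unfolding sum_distrib_left[symmetric] X_row[OF ij] by simp
    finally show "(\<Sum>a<k. \<mu> a * X $$ (i, a) * cnj (X $$ (j, a))) = (if i = j then complex_of_real (\<mu> i) else 0)"
      by simp
  next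
    fix B :: "complex mat" assume B: "B \<in> carrier_mat n n'"
    obtain B1 W Q Y where sb: "split_block B k k = (B1, W, Q, Y)" by (metis prod_cases4)
    note s = split_block[OF sb, of "n - k" "n' - k"]
    have b: "B1 \<in> carrier_mat k k" "W \<in> carrier_mat k (n' - k)" "Q \<in> carrier_mat (n - k) k"
      "Y \<in> carrier_mat (n - k) (n' - k)" "B = four_block_mat B1 W Q Y"
      using s B k_le by auto
    have B1: "B1 $$ (a, l) = B $$ (a, l)" if "a < k" "l < k" for a l
      using b that by simp
    have "mat_trace (mat_adjoint X * B1 * \<Omega>) = (\<Sum>l<k. \<mu> l * (\<Sum>a<k. cnj (X $$ (a, l)) * B $$ (a, l)))"
    proof -
      have XB: "mat_adjoint X * B1 \<in> carrier_mat k k" using b(1) Xd by (auto intro!: carrier_matI)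
      have "mat_trace (mat_adjoint X * B1 * \<Omega>) = (\<Sum>l<k. (mat_adjoint X * B1) $$ (l, l) * \<mu> l)"
        unfolding Omega mat_diag_mult_right[OF XB] by (simp add: mat_trace_def)
      also have "\<dots> = (\<Sum>l<k. \<mu> l * (\<Sum>a<k. cnj (X $$ (a, l)) * B1 $$ (a, l)))"
        using carrier_matD[OF b(1)]
        by (intro sum.cong refl) (simp add: Xd scalar_prod_def atLeast0LessThan mult.commute cong: sum.cong_simp)
      finally show ?thesis by (simp add: B1 cong: sum.cong_simp)
    qed
    then show "\<gamma> B = (lam * (\<Sum>l<k. \<mu> l * (\<Sum>a<k. cnj (X $$ (a, l)) * B $$ (a, l)))) \<cdot>\<^sub>m
        four_block_mat X (0\<^sub>m k (n' - k)) (0\<^sub>m (n - k) k) E"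
      using gamma[OF b(1-4)] b(5) by simp
  next
    show "contraction_on (n - k) (n' - k) (\<lambda>i j. E $$ (i, j))"
      by (rule contraction_mat_imp[OF E])
  qed (fact mu_pos mu_sum k_le X(1) X_col E(1) lambda)+
  have Ed: "dim_row E = n - k" "dim_col E = n' - k" using E(1) by auto
  show ?thesis
  proof
    assume hm: "hyper_maximal n n' \<phi> \<psi> \<gamma>"
    have psd0: "psd_on {..<p} (\<lambda>i j. (1\<^sub>m p - 1\<^sub>m p :: complex mat) $$ (i, j))" for p
      unfolding psd_on_def by simp
    \<comment> \<open>For nonzero \<open>lam\<close> this is the reciprocal of
      \<open>Re (1 / lam)\<close>; for \<open>lam = 0\<close> the competitor has zero diagonal
      blocks. The resulting \<open>c = 1\<close> excludes the second case and gives the equality for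
      \<open>lam\<close> in the first.\<close>
    define c where "c = (if lam = 0 then 0 else (cmod lam)\<^sup>2 / Re lam)"
    have Re_pos: "0 < Re lam" if "lam \<noteq> 0" using that lambda by (smt (verit) zero_less_norm_iff zero_less_power)
    have "c = 1 \<and> 1\<^sub>m n = (1\<^sub>m n :: complex mat) \<and> 1\<^sub>m n' = (1\<^sub>m n' :: complex mat)"
    proof (rule hyper_maximal_imp[OF hm phi psi])
      show "0 \<le> c" "c \<le> 1" "(cmod lam)\<^sup>2 \<le> c * Re lam"
        using Re_pos lambda by (auto simp: c_def)
    qed (use k_le in \<open>simp_all add: psd_on_wt_one psd0\<close>)
    then have lam: "0 < (cmod lam)\<^sup>2" "(cmod lam)\<^sup>2 = Re lam"
      using Re_pos by (auto simp: c_def split: if_splits)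
    have "V * mat_adjoint V = 1\<^sub>m n"
    proof -
      \<comment> \<open>Here \<open>c\<close> stays \<open>1\<close> and only one identity block is
        replaced. The upper left block of \<open>V V\<^sup>*\<close> is
        \<open>X X\<^sup>* = I\<close>, so its first \<open>k\<close> diagonal entries are
        \<open>1\<close>, as the comparison requires.\<close>
      have "1 = (1::real) \<and> V * mat_adjoint V = 1\<^sub>m n \<and> 1\<^sub>m n' = (1\<^sub>m n' :: complex mat)"
      proof (rule hyper_maximal_imp[OF hm phi psi])
        show "(V * mat_adjoint V) $$ (i, i) = 1" if "i < k" for i
          using that Xd unfolding V_adjoint_mult XX by simp
      qed (use k_le lambda in \<open>simp_all add: psd_on_wt_mult_adjoint psd_on_one_minus_VV VV_carrier psd0\<close>)
      then show ?thesis by simp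
    qed
    moreover have "mat_adjoint V * V = 1\<^sub>m n'"
    proof -
      have "1 = (1::real) \<and> 1\<^sub>m n = (1\<^sub>m n :: complex mat) \<and> mat_adjoint V * V = 1\<^sub>m n'"
      proof (rule hyper_maximal_imp[OF hm phi psi])
        show "(mat_adjoint V * V) $$ (i, i) = 1" if "i < k" for i
          using that Xd unfolding V_adjoint_mult XX by simp
      qed (use k_le lambda in \<open>simp_all add: psd_on_wt_adjoint_mult psd_on_one_minus_VV VV_carrier psd0\<close>)
      then show ?thesis by simp
    qed
    ultimately have VV: "V * mat_adjoint V = 1\<^sub>m n" "mat_adjoint V * V = 1\<^sub>m n'" .
    have "mat_trace (V * mat_adjoint V) = mat_trace (mat_adjoint V * V)"
      by (rule mat_trace_mult_commute[of _ n n']) (auto intro!: carrier_matI simp: V_dim)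
    then have nn: "n = n'" unfolding VV mat_trace_one by simp
    have "(E * mat_adjoint E) $$ (i, j) = 1\<^sub>m (n - k) $$ (i, j)" if "i < n - k" "j < n - k" for i j
    proof -
      have "(V * mat_adjoint V) $$ (k + i, k + j) = 1\<^sub>m n $$ (k + i, k + j)" unfolding VV ..
      then show ?thesis using that Xd Ed unfolding V_adjoint_mult by (simp del: index_mult_mat(1))
    qed
    then have "E * mat_adjoint E = 1\<^sub>m (n - k)" using Ed by (intro eq_matI) auto
    moreover have "(mat_adjoint E * E) $$ (i, j) = 1\<^sub>m (n' - k) $$ (i, j)" if "i < n' - k" "j < n' - k" for i j
    proof -
      have "(mat_adjoint V * V) $$ (k + i, k + j) = 1\<^sub>m n' $$ (k + i, k + j)" unfolding VV ..
      then show ?thesis using that Xd Ed unfolding V_adjoint_mult by (simp del: index_mult_mat(1))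
    qed
    then have "mat_adjoint E * E = 1\<^sub>m (n' - k)" using Ed by (intro eq_matI) auto
    ultimately have "unitary_mat E" using Ed nn by (simp add: unitary_mat_def)
    with nn lam show "n = n' \<and> 0 < (cmod lam)\<^sup>2 \<and> (cmod lam)\<^sup>2 = Re lam \<and> unitary_mat E" by simp
  next
    assume R: "n = n' \<and> 0 < (cmod lam)\<^sup>2 \<and> (cmod lam)\<^sup>2 = Re lam \<and> unitary_mat E"
    then have nn: "n = n'" and lam: "0 < (cmod lam)\<^sup>2" "(cmod lam)\<^sup>2 = Re lam" and uE: "unitary_mat E"
      by blast+
    have EE: "E * mat_adjoint E = 1\<^sub>m (n - k)" "mat_adjoint E * E = 1\<^sub>m (n - k)"
      using uE unfolding unitary_mat_def Ed by blast+
    have nk: "k + (n - k) = n" "k + (n' - k) = n'" using k_le by simp_all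
    have VV: "V * mat_adjoint V = 1\<^sub>m n"
      unfolding V_adjoint_mult XX EE four_block_one_mat nk ..
    have VV': "mat_adjoint V * V = 1\<^sub>m n'"
      unfolding V_adjoint_mult XX EE(2)[unfolded nn] four_block_one_mat nk ..
    show "hyper_maximal n n' \<phi> \<psi> \<gamma>"
      by (rule hyper_maximalI[OF corner phi psi lam VV VV'])
  qed
qed

end
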